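(* Let $A$ and $B$ be $d\times d$ positive semidefinite matrices with spectral decompositions $A=\sum_k a_kA_k$ and $B=\sum_l b_lB_l$, where $a_k,b_l\ge0$ and $\{A_k\}$, $\{B_l\}$ are complete sets of mutually orthogonal projectors (so $\sum_kA_k=\sum_lB_l=I$). Let $g:[0,\infty)\to\mathbb{R}$, extended to positive semidefinite matrices by functional calculus. Then $$\operatorname{tr}\big(g(A+B)-g(A)-g(B)\big)\le\sum_{k,l}\big(g(2\sqrt{a_kb_l})-2g(\sqrt{a_kb_l})\big)\operatorname{tr}(A_kB_l)$$ holds if $g\in\mathsf{BF}1$, and also if $g\in\mathsf{CM}0$ provided $A,B$ are positive definite. The reversed inequality holds if $g\in\mathsf{BF}0\cup\mathsf{BF}2$. Equality holds if $g$ is a quadratic polynomial.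
   Context: $\mathsf{CM}0$ is the class of functions $f:(0,\infty)\to\mathbb{R}$ of the form $f(x)=\int_{(0,\infty)} e^{-xt}\,\mu(dt)$ for a positive measure $\mu$ on $(0,\infty)$ with the integral finite for every $x>0$. $\mathsf{BF}0$ is the class of functions $f:[0,\infty)\to\mathbb{R}$ of the form $f(x)=\int_{(0,\infty)}(1-e^{-xt})\,\mu(dt)$, where $\mu$ is a positive measure on $(0,\infty)$ with $\int_{(0,\infty)}\min(1,t)\,\mu(dt)<\infty$. For $k\ge1$, $f\in\mathsf{BF}k$ iff there is $g\in\mathsf{BF}(k-1)$ with $f(x)=\int_0^x g(s)\,ds$ for all $x\ge0$. *)

theory Defs
  imports "HOL-Analysis.Analysis"
begin

definition cadj :: "complex^'n^'n \<Rightarrow> complex^'n^'n" where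
  "cadj M = (\<chi> i j. cnj (M $ j $ i))"

definition hermitian :: "complex^'n^'n \<Rightarrow> bool" where
  "hermitian M \<longleftrightarrow> cadj M = M"

definition psd :: "complex^'n^'n \<Rightarrow> bool" where
  "psd M \<longleftrightarrow> hermitian M \<and>
     (\<forall>x::complex^'n. 0 \<le> Re (\<Sum>i\<in>UNIV. cnj (x $ i) * (M *v x) $ i))"

definition pd :: "complex^'n^'n \<Rightarrow> bool" where
  "pd M \<longleftrightarrow> hermitian M \<and>
     (\<forall>x::complex^'n. x \<noteq> 0 \<longrightarrow> 0 < Re (\<Sum>i\<in>UNIV. cnj (x $ i) * (M *v x) $ i))"

definition unitary :: "complex^'n^'n \<Rightarrow> bool" where
  "unitary U \<longleftrightarrow> cadj U ** U = mat 1"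

definition rdiag :: "('n \<Rightarrow> real) \<Rightarrow> complex^'n^'n" where
  "rdiag v = (\<chi> i j. if i = j then complex_of_real (v i) else 0)"

definition mat_fun :: "(real \<Rightarrow> real) \<Rightarrow> complex^'n^'n \<Rightarrow> complex^'n^'n" where
  "mat_fun g M = (SOME X. \<exists>U v. unitary U \<and> M = U ** rdiag v ** cadj U \<and>
                              X = U ** rdiag (\<lambda>i. g (v i)) ** cadj U)"

definition spec_decomp :: "complex^'n^'n \<Rightarrow> 'k set \<Rightarrow> ('k \<Rightarrow> real) \<Rightarrow> ('k \<Rightarrow> complex^'n^'n) \<Rightarrow> bool" where
  "spec_decomp M K a P \<longleftrightarrow> finite K \<and>
     (\<forall>k\<in>K. 0 \<le> a k) \<and>
     (\<forall>k\<in>K. hermitian (P k) \<and> P k ** P k = P k) \<and>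
     (\<forall>k\<in>K. \<forall>j\<in>K. k \<noteq> j \<longrightarrow> P k ** P j = 0) \<and>
     (\<Sum>k\<in>K. P k) = mat 1 \<and>
     M = (\<Sum>k\<in>K. mat (complex_of_real (a k)) ** P k)"

definition CM0 :: "(real \<Rightarrow> real) \<Rightarrow> bool" where
  "CM0 f \<longleftrightarrow> (\<exists>\<mu>::real measure. sets \<mu> = sets borel \<and> emeasure \<mu> {..0} = 0 \<and>
     (\<forall>x>0. integrable \<mu> (\<lambda>t. exp (- x * t)) \<and> f x = (\<integral>t. exp (- x * t) \<partial>\<mu>)))"

definition BF0 :: "(real \<Rightarrow> real) \<Rightarrow> bool" where
  "BF0 f \<longleftrightarrow> (\<exists>\<mu>::real measure. sets \<mu> = sets borel \<and> emeasure \<mu> {..0} = 0 \<and>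
     (\<integral>\<^sup>+t. ennreal (min 1 t) \<partial>\<mu>) < \<infinity> \<and>
     (\<forall>x\<ge>0. f x = (\<integral>t. (1 - exp (- x * t)) \<partial>\<mu>)))"

fun BF :: "nat \<Rightarrow> (real \<Rightarrow> real) \<Rightarrow> bool" where
  "BF 0 f = BF0 f"
| "BF (Suc k) f = (\<exists>g. BF k g \<and> (\<forall>x\<ge>0. (g has_integral f x) {0..x}))"

definition quadratic_on_nonneg :: "(real \<Rightarrow> real) \<Rightarrow> bool" where
  "quadratic_on_nonneg g \<longleftrightarrow> (\<exists>c0 c1 c2. \<forall>x\<ge>0. g x = c0 + c1 * x + c2 * x\<^sup>2)"

definition trace_gap :: "(real \<Rightarrow> real) \<Rightarrow> complex^'n^'n \<Rightarrow> complex^'n^'n \<Rightarrow> real" where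
  "trace_gap g A B = Re (trace (mat_fun g (A + B) - mat_fun g A - mat_fun g B))"

definition spec_bound :: "(real \<Rightarrow> real) \<Rightarrow> 'k set \<Rightarrow> ('k \<Rightarrow> real) \<Rightarrow> ('k \<Rightarrow> complex^'n^'n)
    \<Rightarrow> 'l set \<Rightarrow> ('l \<Rightarrow> real) \<Rightarrow> ('l \<Rightarrow> complex^'n^'n) \<Rightarrow> real" where
  "spec_bound g K a P L b Q =
     (\<Sum>k\<in>K. \<Sum>l\<in>L. (g (2 * sqrt (a k * b l)) - 2 * g (sqrt (a k * b l))) * Re (trace (P k ** Q l)))"

end

(* Both sides are linear in g and depend only on finitely many values of g. Their difference
   vanishes for 1, x and x^2, and the integral representations of BF_k and CM0 express g as an
   integral of plus or minus exp(-tx), modulo quadratics in x, with positive weights. So it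
   suffices to treat g(x) = exp(-tx). There the Golden-Thompson inequality
   tr exp(-t(A+B)) <= tr exp(-tA) exp(-tB) reduces the claim to the scalar inequality
   (1 - exp(-a)) (1 - exp(-b)) <= (1 - exp(-sqrt(ab)))^2, which is the concavity of
   s |-> ln (1 - exp(-exp s)). Golden-Thompson is the limit of the Lieb-Thirring inequality
   tr (XY)^m <= tr X^m Y^m, m = 2^n, for X = exp(-A/m), Y = exp(-B/m); all these matrices being
   contractions, (XY)^m and exp(-(A+B)) differ by at most m times XY - exp(-(A+B)/m) = O(1/m^2). *)

theory Submission
  imports Defs
begin

subsection \<open>Adjoint, trace and powers\<close>

text \<open>The scalar reduction rests on the weights \<open>rtr (P k ** Q l)\<close>: they are
  nonnegative, and since both systems of projectors sum to the identity, their row and column sums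
  are the traces of \<open>P k\<close> and \<open>Q l\<close>. Hence every term except tr g(A+B) is
  a double sum with these weights. In general A+B shares no eigenbasis with A or B; Golden-Thompson
  bounds its trace by such a double sum too, and what remains for each pair is the one-dimensional
  instance of the claim. The argument sqrt(ab) makes x^2 drop out: (2s)^2 - 2s^2 = 2ab at s =
  sqrt(ab), which matches the cross term 2 tr AB. Each integration multiplies the coefficient of
  exp(-tx) by -1/t, so the inequality alternates in direction, and raises the degree of the
  polynomial part, which reaches 2 at BF2. Two obstacles shape the rest. Coefficients such as 1/t^2
  need not be integrable on their own, so each kernel must stay whole under the integral. And CM0
  controls g only on positive arguments, while a decomposition of a positive definite matrix may
  still list the eigenvalue 0 with a zero projector.\<close>

abbreviation rtr :: "complex^'n^'n \<Rightarrow> real" where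
  "rtr M \<equiv> Re (trace M)"

lemma cadj_mult: "cadj (M ** N) = cadj N ** cadj M"
  by (simp add: cadj_def matrix_matrix_mult_def vec_eq_iff mult.commute)

lemma cadj_cadj [simp]: "cadj (cadj M) = M"
  by (simp add: cadj_def vec_eq_iff)

lemma cadj_add: "cadj (M + N) = cadj M + cadj N"
  by (simp add: cadj_def vec_eq_iff)

lemma cadj_diff: "cadj (M - N) = cadj M - cadj N"
  by (simp add: cadj_def vec_eq_iff)

lemma cadj_scaleR: "cadj (r *\<^sub>R M) = r *\<^sub>R cadj M"
  by (simp add: cadj_def vec_eq_iff)

lemma cadj_zero [simp]: "cadj 0 = 0"
  by (simp add: cadj_def vec_eq_iff)

lemma cadj_one [simp]: "cadj (mat 1) = mat 1"
  by (simp add: cadj_def vec_eq_iff mat_def)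

lemma cadj_sum: "cadj (sum f S) = (\<Sum>x\<in>S. cadj (f x))"
  by (induction S rule: infinite_finite_induct) (auto simp: cadj_add)

lemma cadj_rdiag [simp]: "cadj (rdiag v) = rdiag v"
  by (simp add: cadj_def rdiag_def vec_eq_iff)

lemma matrix_diff_ldistrib: "A ** (B - C) = A ** B - A ** (C :: complex^'n^'n)"
  by (vector matrix_matrix_mult_def sum_subtractf right_diff_distrib)

lemma matrix_diff_rdistrib: "(B - C) ** A = B ** A - C ** (A :: complex^'n^'n)"
  by (vector matrix_matrix_mult_def sum_subtractf left_diff_distrib)

lemma matrix_add_rdistrib: "(B + C) ** A = B ** A + C ** (A :: complex^'n^'n)"
  by (vector matrix_matrix_mult_def sum.distrib distrib_right)

lemma matrix_mult_sum_left: "sum f S ** A = (\<Sum>x\<in>S. f x ** (A :: complex^'n^'n))"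
  by (induction S rule: infinite_finite_induct) (auto simp: matrix_add_rdistrib)

lemma matrix_mult_sum_right: "A ** sum f S = (\<Sum>x\<in>S. (A :: complex^'n^'n) ** f x)"
  by (induction S rule: infinite_finite_induct) (auto simp: matrix_add_ldistrib)

lemma matrix_sum_mult_vec: "sum f S *v x = (\<Sum>k\<in>S. (f k :: complex^'n^'n) *v x)"
  by (induction S rule: infinite_finite_induct) (auto simp: matrix_vector_mult_add_rdistrib)

lemma scaleR_matrix_vec: "(r *\<^sub>R M) *v x = r *\<^sub>R ((M :: complex^'n^'n) *v x)"
  by (simp add: matrix_vector_mult_def vec_eq_iff scaleR_sum_right)

lemma matrix_vec_scaleR: "M *v (r *\<^sub>R x) = r *\<^sub>R ((M :: complex^'n^'n) *v x)"
  by (simp add: matrix_vector_mult_def vec_eq_iff scaleR_sum_right)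

lemma matrix_scaleR_left: "(r *\<^sub>R M) ** N = r *\<^sub>R (M ** N)" for M N :: "complex^'n^'n"
  by (rule scalar_matrix_assoc[symmetric])

lemma matrix_scaleR_right: "M ** (r *\<^sub>R N) = r *\<^sub>R (M ** N)" for M N :: "complex^'n^'n"
  by (simp add: matrix_scalar_ac matrix_scaleR_left)

lemma mat_of_real_mult: "mat (complex_of_real r) ** M = r *\<^sub>R M" for M :: "complex^'n^'n"
proof -
  have "mat (complex_of_real r) = r *\<^sub>R (mat 1 :: complex^'n^'n)"
    by (simp add: mat_def vec_eq_iff) (simp add: scaleR_conv_of_real)
  then show ?thesis
    by (simp add: matrix_scaleR_left)
qed

lemma rtr_sum: "rtr (sum f S) = (\<Sum>x\<in>S. rtr (f x))"
  by (induction S rule: infinite_finite_induct) (auto simp: trace_add trace_0[simplified])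

lemma rtr_scaleR: "rtr (r *\<^sub>R M) = r * rtr M"
  by (simp add: trace_def sum_distrib_left)

lemma rtr_add: "rtr (M + N) = rtr M + rtr N"
  by (simp add: trace_add)

lemma rtr_diff: "rtr (M - N) = rtr M - rtr N"
  by (simp add: trace_sub)

lemma rtr_cadj: "rtr (cadj M) = rtr M"
  by (simp add: trace_def cadj_def)

lemma rtr_cadj_mult_nonneg: "0 \<le> rtr (cadj M ** M)"
proof -
  have "rtr (cadj M ** M) = (\<Sum>i\<in>UNIV. \<Sum>j\<in>UNIV. (norm (M $ j $ i))\<^sup>2)"
    by (simp add: trace_def cadj_def matrix_matrix_mult_def cmod_power2) (simp add: power2_eq_square)
  then show ?thesis
    by (simp add: sum_nonneg)
qed

text \<open>The inner product of the type \<open>complex^'n\<close> is only the real part of this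
  form; orthogonality over the complex numbers needs the form itself.\<close>

definition cip :: "complex^'n \<Rightarrow> complex^'n \<Rightarrow> complex" where
  "cip x y = (\<Sum>i\<in>UNIV. cnj (x $ i) * y $ i)"

lemma inner_eq_Re_cip: "x \<bullet> y = Re (cip x y)"
  by (simp add: cip_def inner_vec_def inner_complex_def)

lemma cip_cadj: "cip x (M *v y) = cip (cadj M *v x) y"
proof -
  have "(\<Sum>i\<in>UNIV. cnj (x $ i) * (\<Sum>j\<in>UNIV. M $ i $ j * y $ j)) =
        (\<Sum>i\<in>UNIV. \<Sum>j\<in>UNIV. cnj (x $ i) * M $ i $ j * y $ j)"
    by (simp add: sum_distrib_left mult.assoc)
  also have "\<dots> = (\<Sum>j\<in>UNIV. \<Sum>i\<in>UNIV. cnj (x $ i) * M $ i $ j * y $ j)"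
    by (rule sum.swap)
  also have "\<dots> = (\<Sum>j\<in>UNIV. cnj (\<Sum>i\<in>UNIV. cnj (M $ i $ j) * x $ i) * y $ j)"
    by (simp add: sum_distrib_left sum_distrib_right mult_ac)
  finally show ?thesis
    by (simp add: cip_def matrix_vector_mult_def cadj_def)
qed

lemma inner_cadj: "x \<bullet> (M *v y) = (cadj M *v x) \<bullet> y"
  by (simp add: inner_eq_Re_cip cip_cadj)

section \<open>Matrix powers and trace inequalities\<close>

primrec mpow :: "complex^'n^'n \<Rightarrow> nat \<Rightarrow> complex^'n^'n" where
  "mpow M 0 = mat 1"
| "mpow M (Suc n) = M ** mpow M n"

lemma mpow_add: "mpow M (m + n) = mpow M m ** mpow M n"
  by (induction m) (auto simp: matrix_mul_assoc)

lemma mpow_mult: "mpow M (n * m) = mpow (mpow M m) n"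
  by (induction n) (auto simp: mpow_add)

lemma mpow_Suc_right: "mpow M (Suc n) = mpow M n ** M"
  using mpow_add[of M n 1] by simp

lemma cadj_mpow: "cadj (mpow M n) = mpow (cadj M) n"
proof (induction n)
  case (Suc n)
  have "cadj (mpow M (Suc n)) = mpow (cadj M) n ** cadj M"
    by (simp add: cadj_mult Suc.IH)
  then show ?case
    by (simp only: mpow_Suc_right)
qed simp

lemma mpow_mult_shift: "M ** mpow (N ** M) n = mpow (M ** N) n ** M"
  for M N :: "complex^'n^'n"
proof (induction n)
  case (Suc n)
  have "M ** mpow (N ** M) (Suc n) = M ** N ** (M ** mpow (N ** M) n)"
    by (simp add: matrix_mul_assoc)
  then show ?case
    by (simp add: Suc.IH matrix_mul_assoc)
qed simp

lemma trace_mpow_comm: "trace (mpow (M ** N) n) = trace (mpow (N ** M) n)"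
  for M N :: "complex^'n^'n"
proof (cases n)
  case (Suc k)
  have "trace (mpow (M ** N) (Suc k)) = trace (M ** (N ** mpow (M ** N) k))"
    by (simp add: matrix_mul_assoc)
  also have "\<dots> = trace ((N ** mpow (M ** N) k) ** M)"
    by (rule trace_mul_sym)
  also have "\<dots> = trace (mpow (N ** M) (Suc k))"
    using mpow_mult_shift[of N M k] 
    by (metis matrix_mul_assoc mpow_Suc_right)
  finally show ?thesis
    using Suc by simp
qed simp

text \<open>The Hilbert-Schmidt norm of \<open>S - T\<close> is nonnegative.\<close>

lemma rtr_mult_le:
  assumes "hermitian S" "hermitian T"
  shows "2 * rtr (S ** T) \<le> rtr (S ** S) + rtr (T ** T)"
proof -
  have "0 \<le> rtr (cadj (S - T) ** (S - T))"
    by (rule rtr_cadj_mult_nonneg)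
  also have "\<dots> = rtr (S ** S) + rtr (T ** T) - rtr (S ** T) - rtr (T ** S)"
    using assms by (simp add: cadj_diff hermitian_def matrix_diff_ldistrib matrix_diff_rdistrib trace_sub)
  finally show ?thesis
    by (simp add: trace_mul_sym[of T S])
qed

lemma hermitian_mpow: "hermitian M \<Longrightarrow> hermitian (mpow M n)"
  by (simp add: hermitian_def cadj_mpow)

text \<open>Expand the Hilbert-Schmidt norm of \<open>X - cadj X\<close>. This is Weyl's inequality
  for the exponent 2, the start of the induction below.\<close>

lemma rtr_square_le: "rtr (X ** X) \<le> rtr (cadj X ** X)"
proof -
  have "0 \<le> rtr (cadj (X - cadj X) ** (X - cadj X))"
    by (rule rtr_cadj_mult_nonneg)
  also have "\<dots> = rtr (cadj X ** X) + rtr (X ** cadj X) - rtr (X ** X) - rtr (cadj (X ** X))"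
    by (simp add: cadj_diff matrix_diff_ldistrib matrix_diff_rdistrib trace_sub cadj_mult)
  finally show ?thesis
    by (simp add: trace_mul_sym[of X "cadj X"] rtr_cadj)
qed

text \<open>Weyl's inequality and the Lieb--Thirring inequality for exponents that are powers of two
  feed each other: Weyl for \<open>X\<^sup>2\<close> reduces to Lieb--Thirring for \<open>X X\<^sup>*\<close> and \<open>X\<^sup>* X\<close>, while
  Weyl for \<open>M N\<close> doubles the exponent in Lieb--Thirring.\<close>

lemma weyl_lieb_thirring:
  "(\<forall>X :: complex^'n^'n. rtr (mpow X (2 ^ Suc n)) \<le> rtr (mpow (cadj X ** X) (2 ^ n))) \<and>
   (\<forall>M N :: complex^'n^'n. hermitian M \<longrightarrow> hermitian N \<longrightarrow>
      rtr (mpow (M ** N) (2 ^ n)) \<le> rtr (mpow M (2 ^ n) ** mpow N (2 ^ n)))"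
proof (induction n)
  case 0
  then show ?case
    using rtr_square_le by (auto simp: numeral_2_eq_2)
next
  case (Suc n)
  have sq: "mpow X (2 ^ Suc m) = mpow (X ** X) (2 ^ m)" for X :: "complex^'n^'n" and m
    using mpow_mult[of X "2 ^ m" 2] by (simp add: mult.commute numeral_2_eq_2)
  have dbl: "mpow X (2 ^ Suc m) = mpow X (2 ^ m) ** mpow X (2 ^ m)" for X :: "complex^'n^'n" and m
    using mpow_add[of X "2 ^ m" "2 ^ m"] by (simp add: mult_2)
  have weyl: "rtr (mpow X (2 ^ Suc n)) \<le> rtr (mpow (cadj X ** X) (2 ^ n))"
    and lt: "hermitian M \<Longrightarrow> hermitian N \<Longrightarrow>
      rtr (mpow (M ** N) (2 ^ n)) \<le> rtr (mpow M (2 ^ n) ** mpow N (2 ^ n))"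
    for X M N :: "complex^'n^'n"
    using Suc.IH by auto
  have "rtr (mpow X (2 ^ Suc (Suc n))) \<le> rtr (mpow (cadj X ** X) (2 ^ Suc n))" for X :: "complex^'n^'n"
  proof -
    let ?P = "X ** cadj X" and ?Q = "cadj X ** X"
    have herm: "hermitian ?P" "hermitian ?Q"
      by (simp_all add: hermitian_def cadj_mult)
    have "rtr (mpow X (2 ^ Suc (Suc n))) \<le> rtr (mpow (cadj (X ** X) ** (X ** X)) (2 ^ n))"
      unfolding sq[of X "Suc n"] by (rule weyl)
    also have "cadj (X ** X) ** (X ** X) = cadj X ** (?Q ** X)"
      by (simp add: cadj_mult matrix_mul_assoc)
    also have "trace (mpow (cadj X ** (?Q ** X)) (2 ^ n)) = trace (mpow (?Q ** X ** cadj X) (2 ^ n))"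
      by (rule trace_mpow_comm)
    also have "?Q ** X ** cadj X = ?Q ** ?P"
      by (simp add: matrix_mul_assoc)
    also have "rtr (mpow (?Q ** ?P) (2 ^ n)) \<le> rtr (mpow ?Q (2 ^ n) ** mpow ?P (2 ^ n))"
      using lt herm by blast
    \<comment> \<open>Splitting off the product costs nothing: \<open>?P\<close> and
      \<open>?Q\<close> are the same product in opposite orders, so their powers have equal traces
      and the mean equals either one.\<close>
    also have "\<dots> \<le> (rtr (mpow ?Q (2 ^ Suc n)) + rtr (mpow ?P (2 ^ Suc n))) / 2"
      unfolding dbl using rtr_mult_le[OF hermitian_mpow[OF herm(2)] hermitian_mpow[OF herm(1)]]
      by (simp add: field_simps)
    also have "\<dots> = rtr (mpow ?Q (2 ^ Suc n))"
      using trace_mpow_comm[of X "cadj X"] by simp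
    finally show ?thesis .
  qed
  moreover have "rtr (mpow (M ** N) (2 ^ Suc n)) \<le> rtr (mpow M (2 ^ Suc n) ** mpow N (2 ^ Suc n))"
    if "hermitian M" "hermitian N" for M N :: "complex^'n^'n"
  proof -
    have herm: "hermitian (M ** M)" "hermitian (N ** N)"
      using that by (simp_all add: hermitian_def cadj_mult)
    have "rtr (mpow (M ** N) (2 ^ Suc n)) \<le> rtr (mpow (cadj (M ** N) ** (M ** N)) (2 ^ n))"
      by (rule weyl)
    also have "cadj (M ** N) ** (M ** N) = N ** (M ** M ** N)"
      using that by (simp add: cadj_mult hermitian_def matrix_mul_assoc)
    also have "trace (mpow (N ** (M ** M ** N)) (2 ^ n)) = trace (mpow (M ** M ** N ** N) (2 ^ n))"
      by (rule trace_mpow_comm)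
    also have "M ** M ** N ** N = (M ** M) ** (N ** N)"
      by (simp add: matrix_mul_assoc)
    also have "rtr (mpow ((M ** M) ** (N ** N)) (2 ^ n)) \<le> rtr (mpow (M ** M) (2 ^ n) ** mpow (N ** N) (2 ^ n))"
      using lt herm by blast
    finally show ?thesis
      by (simp only: sq)
  qed
  ultimately show ?case
    by blast
qed

subsection \<open>Orthogonal resolutions of the identity\<close>

text \<open>Coefficients depend on the index, not on the eigenvalue, so sums, products and functions
  of such matrices are computed index by index even when eigenvalues repeat.\<close>

definition spec_sum :: "'k set \<Rightarrow> ('k \<Rightarrow> complex^'n^'n) \<Rightarrow> ('k \<Rightarrow> real) \<Rightarrow> complex^'n^'n" where
  "spec_sum K P f = (\<Sum>k\<in>K. f k *\<^sub>R P k)"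

lemma spec_sum_add: "spec_sum K P (\<lambda>k. f k + g k) = spec_sum K P f + spec_sum K P g"
  by (simp add: spec_sum_def scaleR_add_left sum.distrib)

lemma spec_sum_diff: "spec_sum K P (\<lambda>k. f k - g k) = spec_sum K P f - spec_sum K P g"
  by (simp add: spec_sum_def scaleR_diff_left sum_subtractf)

lemma spec_sum_scale: "spec_sum K P (\<lambda>k. r * f k) = r *\<^sub>R spec_sum K P f"
  by (simp add: spec_sum_def scaleR_sum_right)

lemma rtr_spec_sum: "rtr (spec_sum K P f) = (\<Sum>k\<in>K. f k * rtr (P k))"
  by (simp add: spec_sum_def rtr_sum rtr_scaleR)

lemma rtr_spec_sum_mult:
  "rtr (spec_sum K P f ** spec_sum L Q g) = (\<Sum>k\<in>K. \<Sum>l\<in>L. f k * g l * rtr (P k ** Q l))"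
proof -
  have "spec_sum K P f ** spec_sum L Q g = (\<Sum>k\<in>K. \<Sum>l\<in>L. (f k * g l) *\<^sub>R (P k ** Q l))"
    unfolding spec_sum_def matrix_mult_sum_left
    by (simp add: matrix_mult_sum_right matrix_scaleR_left matrix_scaleR_right scaleR_sum_right mult.commute)
  then show ?thesis
    by (simp add: rtr_sum rtr_scaleR)
qed

section \<open>Operator norm bounds\<close>

lemma norm_axis_complex: "norm (axis i 1 :: complex^'n) = 1"
proof -
  have "(\<Sum>j\<in>UNIV. (norm ((axis i 1 :: complex^'n) $ j))\<^sup>2) = (\<Sum>j\<in>UNIV. if j = i then 1 else 0)"
    by (intro sum.cong) (auto simp: axis_def)
  then show ?thesis
    by (simp add: norm_vec_def L2_set_def)
qed

definition bounded_by :: "complex^'n^'n \<Rightarrow> real \<Rightarrow> bool" where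
  "bounded_by M C \<longleftrightarrow> (\<forall>x. norm (M *v x) \<le> C * norm x)"

lemma bounded_by_add: "bounded_by M C \<Longrightarrow> bounded_by N D \<Longrightarrow> bounded_by (M + N) (C + D)"
  unfolding bounded_by_def
  by (auto simp: matrix_vector_mult_add_rdistrib distrib_right intro!: norm_triangle_mono)

lemma bounded_by_diff: "bounded_by M C \<Longrightarrow> bounded_by N D \<Longrightarrow> bounded_by (M - N) (C + D)"
  unfolding bounded_by_def
  by (auto simp: matrix_vector_mult_diff_rdistrib distrib_right
      intro!: order_trans[OF norm_triangle_ineq4] add_mono)

lemma bounded_by_mult:
  assumes "bounded_by M C" "bounded_by N D" "0 \<le> C"
  shows "bounded_by (M ** N) (C * D)"
  unfolding bounded_by_def
proof
  fix x
  have "norm ((M ** N) *v x) \<le> C * norm (N *v x)"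
    using assms(1) by (simp add: bounded_by_def matrix_vector_mul_assoc[symmetric])
  also have "\<dots> \<le> C * (D * norm x)"
    using assms(2,3) by (simp add: bounded_by_def mult_left_mono)
  finally show "norm ((M ** N) *v x) \<le> C * D * norm x"
    by (simp add: mult.assoc)
qed

lemma bounded_by_scaleR: "bounded_by M C \<Longrightarrow> 0 \<le> r \<Longrightarrow> bounded_by (r *\<^sub>R M) (r * C)"
  by (auto simp: bounded_by_def scaleR_matrix_vec mult.assoc mult_left_mono)

lemma bounded_by_mpow: "bounded_by M 1 \<Longrightarrow> bounded_by (mpow M n) 1"
proof (induction n)
  case 0
  then show ?case by (simp add: bounded_by_def)
next
  case (Suc n)
  then show ?case using bounded_by_mult[of M 1 "mpow M n" 1] by simp
qed

text \<open>Telescoping: each of the n factors is exchanged once, at cost e, and the remaining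
  factors are contractions. The error therefore grows linearly in n.\<close>

lemma bounded_by_mpow_diff:
  fixes X Z :: "complex^'n^'n" and e :: real
  assumes "bounded_by X 1" "bounded_by Z 1" "bounded_by (X - Z) e"
  shows "bounded_by (mpow X n - mpow Z n) (n * e)"
proof (induction n)
  case 0
  then show ?case by (simp add: bounded_by_def)
next
  case (Suc n)
  have eq: "mpow X (Suc n) - mpow Z (Suc n) = X ** (mpow X n - mpow Z n) + (X - Z) ** mpow Z n"
    by (simp add: matrix_diff_ldistrib matrix_diff_rdistrib)
  \<comment> \<open>A basis vector has norm 1, so a bound on any matrix is nonnegative.\<close>
  have "0 \<le> e"
  proof -
    have "0 \<le> e * norm (axis undefined 1 :: complex^'n)"
      using assms(3) order_trans[OF norm_ge_zero] unfolding bounded_by_def by blast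
    then show ?thesis by (simp add: norm_axis_complex)
  qed
  have "bounded_by (mpow X (Suc n) - mpow Z (Suc n)) (1 * (n * e) + e * 1)"
    unfolding eq
    by (intro bounded_by_add bounded_by_mult bounded_by_mpow assms Suc.IH \<open>0 \<le> e\<close>) simp
  then show ?case
    by (simp add: algebra_simps)
qed

lemma rtr_bounded_by:
  fixes M :: "complex^'n^'n" and C :: real
  assumes "bounded_by M C"
  shows "\<bar>rtr M\<bar> \<le> CARD('n) * C"
proof -
  have diag: "\<bar>Re (M $ i $ i)\<bar> \<le> C" for i
  proof -
    have "(M *v axis i 1) $ i = (\<Sum>j\<in>UNIV. if j = i then M $ i $ i else 0)"
      unfolding matrix_vector_mult_def axis_def vec_lambda_beta by (intro sum.cong) auto
    then have "(M *v axis i 1) $ i = M $ i $ i"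
      by simp
    then have "\<bar>Re (M $ i $ i)\<bar> \<le> norm (M *v axis i 1)"
      using abs_Re_le_cmod[of "M $ i $ i"] Finite_Cartesian_Product.norm_nth_le[of "M *v axis i 1" i] by simp
    also have "\<dots> \<le> C * norm (axis i 1 :: complex^'n)"
      using assms unfolding bounded_by_def by blast
    also have "\<dots> = C"
      by (simp add: norm_axis_complex)
    finally show ?thesis .
  qed
  have "\<bar>rtr M\<bar> \<le> (\<Sum>i\<in>(UNIV::'n set). \<bar>Re (M $ i $ i)\<bar>)"
    by (simp add: trace_def sum_abs)
  also have "\<dots> \<le> CARD('n) * C"
    using sum_bounded_above[of "UNIV::'n set" "\<lambda>i. \<bar>Re (M $ i $ i)\<bar>" C] diag by simp
  finally show ?thesis .
qed

locale projections =
  fixes K :: "'k set" and P :: "'k \<Rightarrow> complex^'n^'n"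
  assumes fin: "finite K"
    and herm: "k \<in> K \<Longrightarrow> hermitian (P k)"
    and idem: "k \<in> K \<Longrightarrow> P k ** P k = P k"
    and orth: "k \<in> K \<Longrightarrow> j \<in> K \<Longrightarrow> k \<noteq> j \<Longrightarrow> P k ** P j = 0"
    and complete: "(\<Sum>k\<in>K. P k) = mat 1"
begin

lemma spec_sum_one [simp]: "spec_sum K P (\<lambda>_. 1) = mat 1"
  by (simp add: spec_sum_def complete)

lemma hermitian_spec_sum: "hermitian (spec_sum K P f)"
  using herm by (simp add: spec_sum_def hermitian_def cadj_sum cadj_scaleR)

lemma proj_mult_spec_sum:
  assumes "k \<in> K"
  shows "P k ** spec_sum K P f = f k *\<^sub>R P k"
proof -
  have "P k ** spec_sum K P f = (\<Sum>j\<in>K. f j *\<^sub>R (P k ** P j))"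
    by (simp add: spec_sum_def matrix_mult_sum_right matrix_scaleR_right)
  also have "\<dots> = (\<Sum>j\<in>K. if j = k then f k *\<^sub>R P k else 0)"
    by (intro sum.cong) (use assms idem orth in auto)
  finally show ?thesis
    using assms fin by simp
qed

lemma spec_sum_mult: "spec_sum K P f ** spec_sum K P g = spec_sum K P (\<lambda>k. f k * g k)"
proof -
  have "spec_sum K P f ** spec_sum K P g = (\<Sum>k\<in>K. f k *\<^sub>R (P k ** spec_sum K P g))"
    unfolding spec_sum_def[of K P f] by (simp add: matrix_mult_sum_left matrix_scaleR_left)
  then show ?thesis
    using proj_mult_spec_sum[of _ g] by (simp add: spec_sum_def[of K P "\<lambda>k. f k * g k"])
qed

lemma spec_sum_mult_proj: "k \<in> K \<Longrightarrow> spec_sum K P f ** P k = f k *\<^sub>R P k"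
  using arg_cong[OF proj_mult_spec_sum[of k f], of cadj] hermitian_spec_sum[of f] herm[of k]
  by (simp add: cadj_mult cadj_scaleR hermitian_def)

lemma mpow_spec_sum: "mpow (spec_sum K P f) n = spec_sum K P (\<lambda>k. f k ^ n)"
  by (induction n) (auto simp: spec_sum_mult)

lemma inner_proj: "k \<in> K \<Longrightarrow> x \<bullet> (P k *v x) = (norm (P k *v x))\<^sup>2"
  using inner_cadj[of x "P k" "P k *v x"] idem[of k] herm[of k]
  by (simp add: matrix_vector_mul_assoc hermitian_def power2_norm_eq_inner)

lemma inner_spec_sum: "x \<bullet> (spec_sum K P f *v x) = (\<Sum>k\<in>K. f k * (norm (P k *v x))\<^sup>2)"
  by (simp add: spec_sum_def matrix_sum_mult_vec scaleR_matrix_vec inner_sum_right inner_proj)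

text \<open>The squared norm of the image of x is the quadratic form of the squared matrix, and the
  numbers \<open>(norm (P k *v x))\<^sup>2\<close> add up to the squared norm of x.\<close>

lemma bounded_by_spec_sum:
  assumes "\<And>k. k \<in> K \<Longrightarrow> \<bar>f k\<bar> \<le> C" "0 \<le> C"
  shows "bounded_by (spec_sum K P f) C"
  unfolding bounded_by_def
proof
  fix x
  have "(norm (spec_sum K P f *v x))\<^sup>2 = x \<bullet> (spec_sum K P (\<lambda>k. f k * f k) *v x)"
    using inner_cadj[of x "spec_sum K P f" "spec_sum K P f *v x"] hermitian_spec_sum[of f]
    by (simp add: hermitian_def power2_norm_eq_inner matrix_vector_mul_assoc spec_sum_mult)
  also have "\<dots> = (\<Sum>k\<in>K. (f k)\<^sup>2 * (norm (P k *v x))\<^sup>2)"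
    by (simp add: inner_spec_sum power2_eq_square)
  also have "\<dots> \<le> (\<Sum>k\<in>K. C\<^sup>2 * (norm (P k *v x))\<^sup>2)"
    using assms by (intro sum_mono mult_right_mono) (auto simp: abs_le_square_iff[symmetric])
  also have "\<dots> = C\<^sup>2 * (x \<bullet> (spec_sum K P (\<lambda>_. 1) *v x))"
    by (simp only: inner_spec_sum sum_distrib_left) simp
  also have "\<dots> = (C * norm x)\<^sup>2"
    by (simp add: power2_norm_eq_inner power_mult_distrib)
  finally show "norm (spec_sum K P f *v x) \<le> C * norm x"
    using assms by (simp add: power2_le_iff_abs_le)
qed

text \<open>The sum is a crude stand-in for the maximum; in the limit below only the order in the
  step size matters.\<close>

lemma bounded_by_spec_sum_sum:
  assumes "\<And>k. k \<in> K \<Longrightarrow> 0 \<le> g k" "\<And>k. k \<in> K \<Longrightarrow> \<bar>f k\<bar> \<le> g k"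
  shows "bounded_by (spec_sum K P f) (\<Sum>k\<in>K. g k)"
proof (rule bounded_by_spec_sum)
  fix k assume "k \<in> K"
  then have "g k \<le> (\<Sum>k\<in>K. g k)"
    using assms(1) fin by (intro member_le_sum) auto
  then show "\<bar>f k\<bar> \<le> (\<Sum>k\<in>K. g k)"
    using assms(2)[OF \<open>k \<in> K\<close>] by simp
qed (simp add: assms sum_nonneg)

end

lemma spec_decomp_projections: "spec_decomp M K a P \<Longrightarrow> projections K P"
  by (simp add: spec_decomp_def projections_def)

lemma spec_decomp_eq: "spec_decomp M K a P \<Longrightarrow> M = spec_sum K P a"
  by (simp add: spec_decomp_def spec_sum_def mat_of_real_mult)

text \<open>Comparing \<open>P k ** M ** R j\<close> computed in both ways shows that \<open>P k ** R j\<close> vanishes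
  unless the eigenvalues \<open>a k\<close> and \<open>c j\<close> agree.\<close>

lemma spec_sum_unique:
  assumes "projections K P" "projections J R" "spec_sum K P a = spec_sum J R c"
  shows "spec_sum K P (\<lambda>k. f (a k)) = spec_sum J R (\<lambda>j. f (c j))"
proof -
  interpret P: projections K P by fact
  interpret R: projections J R by fact
  have eq: "f (a k) *\<^sub>R (P k ** R j) = f (c j) *\<^sub>R (P k ** R j)" if "k \<in> K" "j \<in> J" for k j
  proof -
    have "a k *\<^sub>R (P k ** R j) = P k ** spec_sum K P a ** R j"
      using that by (simp add: P.proj_mult_spec_sum matrix_scaleR_left)
    also have "\<dots> = P k ** (spec_sum J R c ** R j)"
      by (simp add: assms(3) matrix_mul_assoc)
    also have "\<dots> = c j *\<^sub>R (P k ** R j)"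
      using that by (simp add: R.spec_sum_mult_proj matrix_scaleR_right)
    finally show ?thesis
      by (metis scaleR_cancel_right)
  qed
  have "spec_sum K P (\<lambda>k. f (a k)) = spec_sum K P (\<lambda>k. f (a k)) ** (\<Sum>j\<in>J. R j)"
    by (simp add: R.complete)
  also have "\<dots> = (\<Sum>k\<in>K. \<Sum>j\<in>J. f (a k) *\<^sub>R (P k ** R j))"
    unfolding spec_sum_def matrix_mult_sum_left
    by (simp add: matrix_mult_sum_right matrix_scaleR_left scaleR_sum_right)
  also have "\<dots> = (\<Sum>k\<in>K. \<Sum>j\<in>J. f (c j) *\<^sub>R (P k ** R j))"
    using eq by (intro sum.cong refl) blast
  also have "\<dots> = (\<Sum>k\<in>K. P k) ** spec_sum J R (\<lambda>j. f (c j))"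
    unfolding spec_sum_def matrix_mult_sum_left
    by (simp add: matrix_mult_sum_right matrix_scaleR_right scaleR_sum_right)
  finally show ?thesis
    by (simp add: P.complete)
qed

subsection \<open>The Golden--Thompson inequality\<close>

lemma exp_neg_bounds:
  fixes s :: real
  assumes "0 \<le> s"
  shows "\<bar>exp (- s) - 1\<bar> \<le> s" "\<bar>exp (- s) - 1 + s\<bar> \<le> s\<^sup>2"
proof -
  have lower: "1 - s \<le> exp (- s)"
    using exp_ge_add_one_self[of "- s"] by simp
  \<comment> \<open>The product is 1 + s^3. Replacing 1 + s by exp s and dividing by it gives the
    upper bound.\<close>
  have "1 \<le> (1 - s + s\<^sup>2) * (1 + s)"
    using assms by (simp add: algebra_simps power2_eq_square)
  also have "\<dots> \<le> (1 - s + s\<^sup>2) * exp s"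
  proof (rule mult_left_mono)
    have "1 - s + s\<^sup>2 = (1 - s / 2)\<^sup>2 + 3 / 4 * s\<^sup>2"
      by (simp add: power2_eq_square field_simps)
    then show "0 \<le> 1 - s + s\<^sup>2"
      by simp
  qed (use exp_ge_add_one_self[of s] in simp)
  finally have upper: "exp (- s) \<le> 1 - s + s\<^sup>2"
    by (simp add: exp_minus field_simps)
  show "\<bar>exp (- s) - 1\<bar> \<le> s" "\<bar>exp (- s) - 1 + s\<bar> \<le> s\<^sup>2"
    using lower upper assms by auto
qed

context projections
begin

definition exp_neg :: "('k \<Rightarrow> real) \<Rightarrow> real \<Rightarrow> complex^'n^'n" where
  "exp_neg a h = spec_sum K P (\<lambda>k. exp (- (h * a k)))"

lemma hermitian_exp_neg: "hermitian (exp_neg a h)"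
  by (simp add: exp_neg_def hermitian_spec_sum)

lemma mpow_exp_neg: "mpow (exp_neg a h) n = exp_neg a (n * h)"
  by (simp add: exp_neg_def mpow_spec_sum exp_of_nat_mult[symmetric] mult_ac)

lemma exp_neg_minus_one: "exp_neg a h - mat 1 = spec_sum K P (\<lambda>k. exp (- (h * a k)) - 1)"
  by (simp add: exp_neg_def spec_sum_diff)

lemma exp_neg_bounded:
  assumes "\<And>k. k \<in> K \<Longrightarrow> 0 \<le> a k"
  obtains C where "0 \<le> C"
    "bounded_by (spec_sum K P a) C"
    "\<And>h. 0 \<le> h \<Longrightarrow> bounded_by (exp_neg a h) 1"
    "\<And>h. 0 \<le> h \<Longrightarrow> bounded_by (exp_neg a h - mat 1) (C * h)"
    "\<And>h. 0 \<le> h \<Longrightarrow> bounded_by (exp_neg a h - mat 1 + h *\<^sub>R spec_sum K P a) (C * h\<^sup>2)"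
proof
  \<comment> \<open>\<open>a k\<close> pays for the norm and the first-order error, its square for
    the second-order one; a single constant then serves all the estimates.\<close>
  let ?C = "\<Sum>k\<in>K. a k + (a k)\<^sup>2"
  show "0 \<le> ?C"
    by (simp add: assms sum_nonneg)
  show "bounded_by (spec_sum K P a) ?C"
    using assms by (intro bounded_by_spec_sum_sum) auto
  fix h :: real
  assume h: "0 \<le> h"
  show "bounded_by (exp_neg a h) 1"
    unfolding exp_neg_def using assms h by (intro bounded_by_spec_sum) auto
  have "bounded_by (exp_neg a h - mat 1) (\<Sum>k\<in>K. (a k + (a k)\<^sup>2) * h)"
    unfolding exp_neg_minus_one
  proof (rule bounded_by_spec_sum_sum)
    fix k assume k: "k \<in> K"
    have "\<bar>exp (- (h * a k)) - 1\<bar> \<le> h * a k"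
      using assms k h by (intro exp_neg_bounds) auto
    also have "\<dots> \<le> (a k + (a k)\<^sup>2) * h"
      using h by (simp add: algebra_simps)
    finally show "\<bar>exp (- (h * a k)) - 1\<bar> \<le> (a k + (a k)\<^sup>2) * h" .
  qed (use assms h in auto)
  then show "bounded_by (exp_neg a h - mat 1) (?C * h)"
    by (simp add: sum_distrib_right)
  have eq: "exp_neg a h - mat 1 + h *\<^sub>R spec_sum K P a =
      spec_sum K P (\<lambda>k. exp (- (h * a k)) - 1 + h * a k)"
    by (simp add: exp_neg_minus_one spec_sum_add spec_sum_scale)
  have "bounded_by (exp_neg a h - mat 1 + h *\<^sub>R spec_sum K P a) (\<Sum>k\<in>K. (a k + (a k)\<^sup>2) * h\<^sup>2)"
    unfolding eq
  proof (rule bounded_by_spec_sum_sum)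
    fix k assume k: "k \<in> K"
    have "\<bar>exp (- (h * a k)) - 1 + h * a k\<bar> \<le> (h * a k)\<^sup>2"
      using assms k h by (intro exp_neg_bounds) auto
    also have "\<dots> \<le> (a k + (a k)\<^sup>2) * h\<^sup>2"
      using h assms[OF k] by (simp add: algebra_simps)
    finally show "\<bar>exp (- (h * a k)) - 1 + h * a k\<bar> \<le> (a k + (a k)\<^sup>2) * h\<^sup>2" .
  qed (use assms h in auto)
  then show "bounded_by (exp_neg a h - mat 1 + h *\<^sub>R spec_sum K P a) (?C * h\<^sup>2)"
    by (simp add: sum_distrib_right)
qed

end

text \<open>Stating both traces through eigenvalues and projectors avoids a matrix exponential. The
  exponents are powers of 2 because Lieb-Thirring was shown only for these.\<close>

theorem golden_thompson:
  fixes A B :: "complex^'n^'n"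
  assumes A: "spec_decomp A K a P" and B: "spec_decomp B L b Q" and AB: "spec_decomp (A + B) J c R"
  shows "(\<Sum>j\<in>J. exp (- c j) * rtr (R j)) \<le>
         (\<Sum>k\<in>K. \<Sum>l\<in>L. exp (- a k) * exp (- b l) * rtr (P k ** Q l))"
proof -
  interpret P: projections K P using A by (rule spec_decomp_projections)
  interpret Q: projections L Q using B by (rule spec_decomp_projections)
  interpret R: projections J R using AB by (rule spec_decomp_projections)
  have pos: "\<And>k. k \<in> K \<Longrightarrow> 0 \<le> a k" "\<And>l. l \<in> L \<Longrightarrow> 0 \<le> b l" "\<And>j. j \<in> J \<Longrightarrow> 0 \<le> c j"
    using A B AB by (auto simp: spec_decomp_def)
  have Aeq: "A = spec_sum K P a" and Beq: "B = spec_sum L Q b"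
    and sum_eq: "spec_sum J R c = spec_sum K P a + spec_sum L Q b"
    using A B AB by (metis spec_decomp_eq)+
  obtain C1 where C1: "0 \<le> C1" "bounded_by (spec_sum K P a) C1"
    "\<And>h. 0 \<le> h \<Longrightarrow> bounded_by (P.exp_neg a h) 1"
    "\<And>h. 0 \<le> h \<Longrightarrow> bounded_by (P.exp_neg a h - mat 1) (C1 * h)"
    "\<And>h. 0 \<le> h \<Longrightarrow> bounded_by (P.exp_neg a h - mat 1 + h *\<^sub>R spec_sum K P a) (C1 * h\<^sup>2)"
    using P.exp_neg_bounded[of a, OF pos(1)] by blast
  obtain C2 where C2: "0 \<le> C2" "bounded_by (spec_sum L Q b) C2"
    "\<And>h. 0 \<le> h \<Longrightarrow> bounded_by (Q.exp_neg b h) 1"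
    "\<And>h. 0 \<le> h \<Longrightarrow> bounded_by (Q.exp_neg b h - mat 1) (C2 * h)"
    "\<And>h. 0 \<le> h \<Longrightarrow> bounded_by (Q.exp_neg b h - mat 1 + h *\<^sub>R spec_sum L Q b) (C2 * h\<^sup>2)"
    using Q.exp_neg_bounded[of b, OF pos(2)] by blast
  obtain C3 where C3: "0 \<le> C3" "bounded_by (spec_sum J R c) C3"
    "\<And>h. 0 \<le> h \<Longrightarrow> bounded_by (R.exp_neg c h) 1"
    "\<And>h. 0 \<le> h \<Longrightarrow> bounded_by (R.exp_neg c h - mat 1) (C3 * h)"
    "\<And>h. 0 \<le> h \<Longrightarrow> bounded_by (R.exp_neg c h - mat 1 + h *\<^sub>R spec_sum J R c) (C3 * h\<^sup>2)"
    using R.exp_neg_bounded[of c, OF pos(3)] by blast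
  \<comment> \<open>The four summands come from the four terms of the splitting of
    \<open>?X ** ?Y - ?Z\<close> below.\<close>
  define D where "D = C1 + C2 + C1 * C2 + C3"
  have "0 \<le> D"
    using C1(1) C2(1) C3(1) by (simp add: D_def)
  let ?T = "rtr (P.exp_neg a 1 ** Q.exp_neg b 1)"
  have step: "rtr (R.exp_neg c 1) \<le> ?T + CARD('n) * D * (1 / 2) ^ n" for n
  proof -
    define h :: real where "h = 1 / 2 ^ n"
    have h: "0 \<le> h" "real (2 ^ n) * h = 1" "real (2 ^ n) * h\<^sup>2 = (1 / 2) ^ n"
      by (auto simp: h_def power2_eq_square power_divide)
    let ?X = "P.exp_neg a h" and ?Y = "Q.exp_neg b h" and ?Z = "R.exp_neg c h"
    let ?A = "spec_sum K P a" and ?B = "spec_sum L Q b"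
    \<comment> \<open>As the generator of \<open>?Z\<close> is the sum of those of \<open>?X\<close>
      and \<open>?Y\<close>, all terms of order 0 and 1 in h cancel. Three terms are second-order
      Taylor remainders, and the fourth is a product of two factors of order h.\<close>
    have eq: "?X ** ?Y - ?Z = (?X - mat 1 + h *\<^sub>R ?A) ** ?Y + (?Y - mat 1 + h *\<^sub>R ?B)
        - h *\<^sub>R (?A ** (?Y - mat 1)) - (?Z - mat 1 + h *\<^sub>R spec_sum J R c)"
      by (simp add: matrix_add_ldistrib matrix_diff_ldistrib matrix_add_rdistrib matrix_diff_rdistrib
          matrix_scaleR_left sum_eq scaleR_add_right scaleR_diff_right)
    have "bounded_by (?X ** ?Y - ?Z)
        (C1 * h\<^sup>2 * 1 + C2 * h\<^sup>2 + h * (C1 * (C2 * h)) + C3 * h\<^sup>2)"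
      unfolding eq using C1 C2 C3 h(1)
      by (intro bounded_by_add bounded_by_diff bounded_by_mult bounded_by_scaleR) auto
    then have "bounded_by (?X ** ?Y - ?Z) (D * h\<^sup>2)"
      by (simp add: D_def algebra_simps power2_eq_square)
    then have "bounded_by (mpow (?X ** ?Y) (2 ^ n) - mpow ?Z (2 ^ n)) (real (2 ^ n) * (D * h\<^sup>2))"
      using C1(3)[OF h(1)] C2(3)[OF h(1)] C3(3)[OF h(1)] bounded_by_mult[of ?X 1 ?Y 1]
      by (intro bounded_by_mpow_diff) auto
    moreover have "real (2 ^ n) * (D * h\<^sup>2) = D * (1 / 2) ^ n"
      using h(3) by (metis mult.left_commute)
    ultimately have "\<bar>rtr (mpow (?X ** ?Y) (2 ^ n) - mpow ?Z (2 ^ n))\<bar> \<le> CARD('n) * (D * (1 / 2) ^ n)"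
      using rtr_bounded_by by metis
    moreover have "mpow ?Z (2 ^ n) = R.exp_neg c 1" "mpow ?X (2 ^ n) = P.exp_neg a 1"
      "mpow ?Y (2 ^ n) = Q.exp_neg b 1"
      using h(2) by (simp_all add: P.mpow_exp_neg Q.mpow_exp_neg R.mpow_exp_neg)
    moreover have "rtr (mpow (?X ** ?Y) (2 ^ n)) \<le> rtr (mpow ?X (2 ^ n) ** mpow ?Y (2 ^ n))"
      using weyl_lieb_thirring[of n] P.hermitian_exp_neg Q.hermitian_exp_neg by blast
    ultimately show ?thesis
      by (simp add: rtr_diff mult.assoc)
  qed
  have "(\<lambda>n. ?T + CARD('n) * D * (1 / 2) ^ n) \<longlonglongrightarrow> ?T + CARD('n) * D * 0"
    by (intro tendsto_intros LIMSEQ_power_zero) auto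
  then have "rtr (R.exp_neg c 1) \<le> ?T + CARD('n) * D * 0"
    by (rule LIMSEQ_le_const) (use step in blast)
  then show ?thesis
    by (simp add: P.exp_neg_def Q.exp_neg_def R.exp_neg_def rtr_spec_sum rtr_spec_sum_mult)
qed

subsection \<open>The spectral theorem and functional calculus\<close>

text \<open>The first-order condition at an extremum, free of derivatives.\<close>

lemma linear_quadratic_nonneg_imp_zero:
  fixes p s :: real
  assumes "\<And>t. 0 \<le> 2 * t * p + t\<^sup>2 * s"
  shows "p = 0"
proof (rule ccontr)
  assume "p \<noteq> 0"
  \<comment> \<open>At t = -p/d the expression is -(p/d)^2 (2d - s), which is negative as soon as 2d
    exceeds s; this d is also positive.\<close>
  let ?d = "\<bar>s\<bar> + 1"
  have "2 * (- p / d) * p + (- p / d)\<^sup>2 * s = - (p / d)\<^sup>2 * (2 * d - s)" if "d \<noteq> 0" for d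
    using that by (simp add: field_simps power2_eq_square)
  then have "2 * (- p / ?d) * p + (- p / ?d)\<^sup>2 * s = - (p / ?d)\<^sup>2 * (2 * ?d - s)"
    by simp
  also have "\<dots> < 0"
    using \<open>p \<noteq> 0\<close> by (auto simp: mult_less_0_iff)
  finally show False
    using assms[of "- p / ?d"] by simp
qed

text \<open>A maximiser of the Rayleigh quotient is an eigenvector.\<close>

lemma selfadjoint_eigenvector:
  fixes T :: "'a::euclidean_space \<Rightarrow> 'a"
  assumes "linear T" and adj: "\<And>x y. x \<bullet> T y = T x \<bullet> y"
    and W: "subspace W" "\<And>x. x \<in> W \<Longrightarrow> T x \<in> W" and "w \<in> W" "w \<noteq> 0"
  shows "\<exists>x\<in>W. norm x = 1 \<and> (\<exists>c. T x = c *\<^sub>R x)"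
proof -
  interpret T: linear T by fact
  have "compact (W \<inter> sphere 0 1)"
    by (simp add: closed_Int_compact closed_subspace W(1))
  moreover have "w /\<^sub>R norm w \<in> W \<inter> sphere 0 1"
    using W(1) \<open>w \<in> W\<close> \<open>w \<noteq> 0\<close> by (simp add: subspace_scale)
  moreover have "continuous_on (W \<inter> sphere 0 1) (\<lambda>x. x \<bullet> T x)"
    by (intro continuous_intros linear_continuous_on)
      (simp add: linear_conv_bounded_linear[symmetric] \<open>linear T\<close>)
  ultimately have "\<exists>x\<in>W \<inter> sphere 0 1. \<forall>y\<in>W \<inter> sphere 0 1. y \<bullet> T y \<le> x \<bullet> T x"
    by (intro continuous_attains_sup) blast+
  then obtain x where x: "x \<in> W" "norm x = 1"
    and max: "\<And>y. y \<in> W \<Longrightarrow> norm y = 1 \<Longrightarrow> y \<bullet> T y \<le> x \<bullet> T x"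
    by auto
  define c where "c = x \<bullet> T x"
  define q where "q y = c * (y \<bullet> y) - y \<bullet> T y" for y
  have q: "0 \<le> q y" if "y \<in> W" for y
  proof (cases "y = 0")
    case False
    have "(y /\<^sub>R norm y) \<bullet> T (y /\<^sub>R norm y) \<le> c"
      unfolding c_def using that False W(1) by (intro max) (auto simp: subspace_scale)
    then have "(y \<bullet> T y) / (norm y)\<^sup>2 \<le> c"
      by (simp add: T.scale power2_eq_square divide_inverse mult_ac)
    then show ?thesis
      using False by (simp add: q_def field_simps power2_norm_eq_inner)
  qed (simp add: q_def T.zero)
  \<comment> \<open>The form \<open>q\<close> is nonnegative on W and vanishes at the maximiser x.
    Varying x in the direction of the residual r makes the linear coefficient r . r, which must
    therefore be 0.\<close>
  define r where "r = c *\<^sub>R x - T x"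
  have r: "r \<in> W"
    using W x by (simp add: r_def subspace_diff subspace_scale)
  have x_r: "x \<bullet> r = r \<bullet> x" "x \<bullet> T r = r \<bullet> T x"
    by (simp_all only: adj[of x r] inner_commute)
  have "0 \<le> 2 * t * (r \<bullet> r) + t\<^sup>2 * q r" for t
  proof -
    have "q (x + t *\<^sub>R r) = q x + 2 * t * (c * (r \<bullet> x) - r \<bullet> T x) + t\<^sup>2 * q r"
      by (simp add: q_def T.add T.scale inner_add_left inner_add_right algebra_simps
          power2_eq_square x_r)
    moreover have "q x = 0"
      using x by (simp add: q_def c_def power2_norm_eq_inner[symmetric])
    moreover have "c * (r \<bullet> x) - r \<bullet> T x = r \<bullet> (c *\<^sub>R x - T x)"
      by (simp add: inner_diff_right)
    ultimately show ?thesis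
      unfolding r_def[symmetric] using q[of "x + t *\<^sub>R r"] W(1) x(1) r by (simp add: subspace_add subspace_scale)
  qed
  then have "r \<bullet> r = 0"
    by (rule linear_quadratic_nonneg_imp_zero)
  then have "T x = c *\<^sub>R x"
    by (simp add: r_def)
  then show ?thesis
    using x by blast
qed

lemma cip_self: "cip x x = complex_of_real ((norm x)\<^sup>2)"
proof -
  have "cip x x = (\<Sum>i\<in>UNIV. complex_of_real ((norm (x $ i))\<^sup>2))"
    unfolding cip_def by (intro sum.cong refl) (simp only: complex_norm_square mult.commute)
  then show ?thesis
    by (simp add: norm_vec_def L2_set_def sum_nonneg)
qed

lemma cnj_cip: "cnj (cip x y) = cip y x"
  by (simp add: cip_def mult.commute)

lemma cip_add_right: "cip x (y + z) = cip x y + cip x z"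
  by (simp add: cip_def sum.distrib distrib_left)

lemma cip_scaleR_right: "cip x (r *\<^sub>R y) = r *\<^sub>R cip x y"
  by (simp add: cip_def scaleR_sum_right)

lemma cip_scaleR_left: "cip (r *\<^sub>R x) y = r *\<^sub>R cip x y"
  by (simp add: cip_def scaleR_sum_right)

text \<open>The conjugated vectors are the rows of a square matrix whose row i is replaced by 0.
  That matrix is singular, and a vector in its kernel is orthogonal to all e j with j in J.\<close>

lemma exists_orthogonal:
  fixes e :: "'n::finite \<Rightarrow> complex^'n"
  assumes "i \<notin> J"
  shows "\<exists>x. x \<noteq> 0 \<and> (\<forall>j\<in>J. cip (e j) x = 0)"
proof -
  define N :: "complex^'n^'n" where "N = (\<chi> j. if j = i then 0 else (\<chi> k. cnj (e j $ k)))"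
  have "det N = 0"
    unfolding N_def by (rule det_row_0)
  then have "\<not> invertible N"
    by (simp add: invertible_det_nz)
  then obtain x where x: "x \<noteq> 0" "N *v x = 0"
    using matrix_left_invertible_ker[of N] by (auto simp: invertible_left_inverse)
  have "cip (e j) x = (N *v x) $ j" if "j \<in> J" for j
    using that assms by (auto simp: N_def cip_def matrix_vector_mult_def)
  then show ?thesis
    using x by auto
qed

text \<open>The induction runs over the matrix indices themselves, so J = UNIV yields a full
  eigenbasis. Each new vector is a Rayleigh maximiser in the \<open>cip\<close>-complement of the
  earlier ones, which is invariant because M is Hermitian. Maximising over real scalars suffices,
  and makes the eigenvalues real.\<close>

lemma orthonormal_eigenvectors:
  fixes M :: "complex^'n^'n"
  assumes M: "hermitian M" and "finite J"
  shows "\<exists>e v. (\<forall>i\<in>J. \<forall>j\<in>J. cip (e i) (e j) = of_bool (i = j)) \<and>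
               (\<forall>j\<in>J. M *v e j = v j *\<^sub>R (e (j::'n)))"
  using \<open>finite J\<close>
proof induction
  case (insert i J)
  then obtain e v where "(\<forall>i\<in>J. \<forall>j\<in>J. cip (e i) (e j) = of_bool (i = j)) \<and> (\<forall>j\<in>J. M *v e j = v j *\<^sub>R e j)"
    by (elim exE)
  then have e: "\<And>i j. i \<in> J \<Longrightarrow> j \<in> J \<Longrightarrow> cip (e i) (e j) = of_bool (i = j)"
    and v: "\<And>j. j \<in> J \<Longrightarrow> M *v e j = v j *\<^sub>R e j"
    by blast+
  let ?W = "{x. \<forall>j\<in>J. cip (e j) x = 0}"
  obtain w where w: "w \<noteq> 0" "w \<in> ?W"
    using exists_orthogonal[OF insert.hyps(2), of e] by blast
  have "\<exists>x\<in>?W. norm x = 1 \<and> (\<exists>c. M *v x = c *\<^sub>R x)"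
  proof (rule selfadjoint_eigenvector)
    show "subspace ?W"
      by (auto simp: subspace_def cip_add_right cip_scaleR_right) (simp add: cip_def)
    show "M *v x \<in> ?W" if "x \<in> ?W" for x
      using that M v by (auto simp: cip_cadj hermitian_def cip_scaleR_left)
    show "linear ((*v) M)"
      by (auto intro!: linearI simp: matrix_vector_right_distrib matrix_vec_scaleR)
    show "x \<bullet> (M *v y) = (M *v x) \<bullet> y" for x y
      using M by (simp add: inner_cadj hermitian_def)
  qed (use w in auto)
  then obtain x c where x: "x \<in> ?W" "norm x = 1" "M *v x = c *\<^sub>R x"
    by blast
  have x_e: "cip x (e j) = 0" if "j \<in> J" for j
    using that x(1) cnj_cip[of "e j" x] by simp
  have "cip x x = 1"
    using x(2) by (simp add: cip_self)
  show ?case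
  proof (intro exI conjI ballI)
    fix j k assume "j \<in> insert i J" "k \<in> insert i J"
    then show "cip ((e(i := x)) j) ((e(i := x)) k) = of_bool (j = k)"
      using x x_e e insert.hyps(2) \<open>cip x x = 1\<close> by auto
  next
    fix j assume "j \<in> insert i J"
    then show "M *v (e(i := x)) j = (v(i := c)) j *\<^sub>R (e(i := x)) j"
      using x v insert.hyps(2) by auto
  qed
qed simp

theorem hermitian_diagonalizable:
  fixes M :: "complex^'n^'n"
  assumes "hermitian M"
  obtains U v where "unitary U" "M = U ** rdiag v ** cadj U"
proof -
  obtain e :: "'n \<Rightarrow> complex^'n" and v where
    e: "\<And>i j. cip (e i) (e j) = of_bool (i = j)" and v: "\<And>j. M *v e j = v j *\<^sub>R e j"
    using orthonormal_eigenvectors[OF assms finite_class.finite_UNIV] by auto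
  define U :: "complex^'n^'n" where "U = (\<chi> i j. e j $ i)"
  have "(cadj U ** U) $ i $ j = cip (e i) (e j)" for i j
    by (simp add: U_def cadj_def matrix_matrix_mult_def cip_def)
  then have U: "cadj U ** U = mat 1"
    by (simp add: e vec_eq_iff mat_def)
  have "(M ** U) $ i $ j = (U ** rdiag v) $ i $ j" for i j
  proof -
    have "(M ** U) $ i $ j = (M *v e j) $ i"
      by (simp add: U_def matrix_matrix_mult_def matrix_vector_mult_def)
    also have "\<dots> = (\<Sum>k\<in>UNIV. if k = j then e j $ i * complex_of_real (v j) else 0)"
      by (simp add: v) (simp add: scaleR_conv_of_real)
    also have "\<dots> = (U ** rdiag v) $ i $ j"
      unfolding U_def rdiag_def matrix_matrix_mult_def vec_lambda_beta by (intro sum.cong) auto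
    finally show ?thesis .
  qed
  then have "M ** U = U ** rdiag v"
    by (simp add: vec_eq_iff)
  moreover have "M = M ** U ** cadj U"
    using U by (simp add: matrix_mul_assoc[symmetric] matrix_left_right_inverse)
  ultimately show ?thesis
    using that[of U v] U by (simp add: unitary_def)
qed

section \<open>From unitary diagonalisations to projectors\<close>

definition col_proj :: "complex^'n^'n \<Rightarrow> 'n \<Rightarrow> complex^'n^'n" where
  "col_proj U i = U ** rdiag (\<lambda>j. of_bool (j = i)) ** cadj U"

lemma rdiag_mult: "rdiag u ** rdiag v = rdiag (\<lambda>i. u i * v i)"
proof -
  have "(rdiag u ** rdiag v) $ i $ j = rdiag (\<lambda>i. u i * v i) $ i $ j" for i j :: 'a
  proof -
    have "(rdiag u ** rdiag v) $ i $ j =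
        (\<Sum>k\<in>UNIV. if k = i then rdiag (\<lambda>i. u i * v i) $ i $ j else 0)"
      unfolding rdiag_def matrix_matrix_mult_def vec_lambda_beta by (intro sum.cong) auto
    then show ?thesis by simp
  qed
  then show ?thesis by (simp add: vec_eq_iff)
qed

lemma rdiag_spec_sum: "U ** rdiag v ** cadj U = spec_sum UNIV (col_proj U) v"
proof -
  have "rdiag v $ j $ k = (\<Sum>i\<in>UNIV. v i *\<^sub>R rdiag (\<lambda>j. of_bool (j = i))) $ j $ k" for j k
  proof -
    have "(\<Sum>i\<in>UNIV. v i *\<^sub>R rdiag (\<lambda>j. of_bool (j = i))) $ j $ k =
        (\<Sum>i\<in>UNIV. if i = j then rdiag v $ j $ k else 0)"
      unfolding sum_component by (intro sum.cong) (auto simp: rdiag_def of_real_def)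
    then show ?thesis
      by simp
  qed
  then have "rdiag v = (\<Sum>i\<in>UNIV. v i *\<^sub>R rdiag (\<lambda>j. of_bool (j = i)))"
    by (simp add: vec_eq_iff del: sum_component)
  then show ?thesis
    by (simp add: spec_sum_def col_proj_def matrix_mult_sum_left matrix_mult_sum_right
        matrix_scaleR_left matrix_scaleR_right)
qed

lemma projections_col_proj:
  assumes "unitary U"
  shows "projections UNIV (col_proj U)"
proof -
  have inv: "cadj U ** U = mat 1" "U ** cadj U = mat 1"
    using assms by (simp_all add: unitary_def matrix_left_right_inverse)
  have mult: "col_proj U i ** col_proj U j = U ** rdiag (\<lambda>k. of_bool (k = i) * of_bool (k = j)) ** cadj U" for i j
  proof -
    have "col_proj U i ** col_proj U j =
        U ** rdiag (\<lambda>k. of_bool (k = i)) ** (cadj U ** U) ** rdiag (\<lambda>k. of_bool (k = j)) ** cadj U"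
      by (simp add: col_proj_def matrix_mul_assoc)
    also have "\<dots> = U ** (rdiag (\<lambda>k. of_bool (k = i)) ** rdiag (\<lambda>k. of_bool (k = j))) ** cadj U"
      by (simp add: inv matrix_mul_assoc)
    finally show ?thesis
      by (simp add: rdiag_mult)
  qed
  show ?thesis
  proof
    show "hermitian (col_proj U i)" for i
      by (simp add: col_proj_def hermitian_def cadj_mult matrix_mul_assoc)
    show "col_proj U i ** col_proj U i = col_proj U i" for i
      unfolding mult by (simp add: col_proj_def of_bool_conj[symmetric])
    show "col_proj U i ** col_proj U j = 0" if "i \<noteq> j" for i j
    proof -
      have "rdiag (\<lambda>k. of_bool (k = i) * of_bool (k = j)) = 0"
        using that by (auto simp: rdiag_def vec_eq_iff)
      then show ?thesis
        by (simp add: mult)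
    qed
    have "rdiag (\<lambda>_. 1) = (mat 1 :: complex^'a^'a)"
      by (simp add: rdiag_def mat_def vec_eq_iff)
    then have "(\<Sum>i\<in>UNIV. col_proj U i) = U ** cadj U"
      using rdiag_spec_sum[of U "\<lambda>_. 1"] by (simp add: spec_sum_def)
    then show "(\<Sum>i\<in>UNIV. col_proj U i) = mat 1"
      by (simp add: inv)
  qed simp
qed

text \<open>Its trace is 1. A nonzero projector is needed to turn positivity of the quadratic form
  into a sign of the eigenvalue.\<close>

lemma col_proj_nonzero:
  assumes "unitary U"
  shows "col_proj U i \<noteq> 0"
proof -
  have "trace (col_proj U i) = trace (cadj U ** U ** rdiag (\<lambda>j. of_bool (j = i)))"
    unfolding col_proj_def by (subst trace_mul_sym) (simp add: matrix_mul_assoc)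
  also have "\<dots> = (\<Sum>j\<in>UNIV. if j = i then 1 else 0)"
    using assms unfolding trace_def by (intro sum.cong) (auto simp: unitary_def rdiag_def)
  also have "\<dots> = 1"
    by simp
  finally show ?thesis
    by (metis mat_0 trace_0 zero_neq_one)
qed

text \<open>\<open>mat_fun\<close> evaluates g on an arbitrarily chosen diagonalisation. One exists
  by the spectral theorem, and \<open>spec_sum_unique\<close> makes the result independent of the
  choice.\<close>

lemma mat_fun_spec_sum:
  assumes "projections K P"
  shows "mat_fun g (spec_sum K P a) = spec_sum K P (\<lambda>k. g (a k))"
proof -
  let ?M = "spec_sum K P a"
  have herm: "hermitian ?M"
    using assms by (rule projections.hermitian_spec_sum)
  have "\<exists>X U v. unitary U \<and> ?M = U ** rdiag v ** cadj U \<and> X = U ** rdiag (\<lambda>i. g (v i)) ** cadj U"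
    using hermitian_diagonalizable[OF herm] by metis
  from someI_ex[OF this] obtain U v where U: "unitary U" "?M = U ** rdiag v ** cadj U"
    "mat_fun g ?M = U ** rdiag (\<lambda>i. g (v i)) ** cadj U"
    unfolding mat_fun_def by blast
  have "spec_sum K P (\<lambda>k. g (a k)) = spec_sum UNIV (col_proj U) (\<lambda>i. g (v i))"
    using assms projections_col_proj[OF U(1)] U(2)[unfolded rdiag_spec_sum] by (rule spec_sum_unique)
  then show ?thesis
    by (simp add: U(3) rdiag_spec_sum)
qed

lemma (in projections) exists_eigenvector:
  assumes "k \<in> K" "P k \<noteq> 0"
  obtains x where "x \<noteq> 0" "x \<bullet> (spec_sum K P a *v x) = a k * (norm x)\<^sup>2"
proof -
  obtain y where y: "P k *v y \<noteq> 0"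
    using assms(2) matrix_eq[of "P k" 0] by auto
  have "spec_sum K P a *v (P k *v y) = a k *\<^sub>R (P k *v y)"
    using assms(1) by (simp add: matrix_vector_mul_assoc spec_sum_mult_proj scaleR_matrix_vec)
  then show ?thesis
    using that[of "P k *v y"] y by (simp add: power2_norm_eq_inner)
qed

lemma spec_decomp_inner_nonneg:
  assumes "spec_decomp M K a P"
  shows "0 \<le> x \<bullet> (M *v x)"
proof -
  interpret projections K P using assms by (rule spec_decomp_projections)
  show ?thesis
    using assms unfolding spec_decomp_eq[OF assms] inner_spec_sum
    by (auto simp: spec_decomp_def intro!: sum_nonneg)
qed

lemma pd_iff_inner: "pd M \<longleftrightarrow> hermitian M \<and> (\<forall>x. x \<noteq> 0 \<longrightarrow> 0 < x \<bullet> (M *v x))"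
  by (simp add: pd_def inner_eq_Re_cip cip_def)

lemma spec_decomp_pd_pos:
  assumes "spec_decomp M K a P" "pd M" "k \<in> K" "P k \<noteq> 0"
  shows "0 < a k"
proof -
  interpret projections K P using assms(1) by (rule spec_decomp_projections)
  obtain x where "x \<noteq> 0" "x \<bullet> (M *v x) = a k * (norm x)\<^sup>2"
    using exists_eigenvector[OF assms(3,4)] spec_decomp_eq[OF assms(1)] by metis
  then show ?thesis
    using assms(2) by (auto simp: pd_iff_inner zero_less_mult_iff dest: spec)
qed

lemma spec_decomp_exists:
  fixes M :: "complex^'n^'n"
  assumes "hermitian M" "\<And>x. 0 \<le> x \<bullet> (M *v x)"
  obtains v :: "'n \<Rightarrow> real" and R :: "'n \<Rightarrow> complex^'n^'n"
  where "spec_decomp M UNIV v R" "\<And>i. R i \<noteq> 0"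
proof -
  obtain U v where U: "unitary U" "M = U ** rdiag v ** cadj U"
    using hermitian_diagonalizable[OF assms(1)] .
  interpret projections UNIV "col_proj U"
    using U(1) by (rule projections_col_proj)
  have M: "M = spec_sum UNIV (col_proj U) v"
    using U(2) by (simp add: rdiag_spec_sum)
  have "0 \<le> v i" for i
  proof -
    obtain x where x: "x \<noteq> 0" "x \<bullet> (M *v x) = v i * (norm x)\<^sup>2"
      using exists_eigenvector[OF UNIV_I col_proj_nonzero[OF U(1)]] unfolding M by blast
    then show ?thesis
      using assms(2)[of x] by (simp add: zero_le_mult_iff)
  qed
  then have "spec_decomp M UNIV v (col_proj U)"
    using herm idem orth complete M by (simp add: spec_decomp_def spec_sum_def mat_of_real_mult)
  then show ?thesis
    using that col_proj_nonzero[OF U(1)] by blast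
qed

subsection \<open>The scalar inequality\<close>

text \<open>By convexity of exp, the slope of its chord from 0 to x increases with x.\<close>

lemma div_exp_minus_one_antimono:
  fixes x y :: real
  assumes "0 < x" "x \<le> y"
  shows "y / (exp y - 1) \<le> x / (exp x - 1)"
proof -
  have "exp ((1 - x / y) *\<^sub>R 0 + (x / y) *\<^sub>R y) \<le> (1 - x / y) * exp 0 + (x / y) * exp y"
    using assms by (intro convex_onD[OF exp_convex]) auto
  then have "exp x - 1 \<le> (x / y) * (exp y - 1)"
    using assms by (simp add: algebra_simps)
  then show ?thesis
    using assms by (simp add: field_simps)
qed

text \<open>The function \<open>s \<mapsto> ln (1 - exp (- exp s))\<close> is concave, its derivative being
  \<open>x / (exp x - 1)\<close> at \<open>x = exp s\<close>; so \<open>1 - exp (- x)\<close> is geometrically midpoint concave.\<close>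

lemma one_minus_exp_geometric_mean:
  fixes a b :: real
  assumes "0 \<le> a" "0 \<le> b"
  shows "(1 - exp (- a)) * (1 - exp (- b)) \<le> (1 - exp (- sqrt (a * b)))\<^sup>2"
\<comment> \<open>The substitution a = exp s excludes 0; there both sides vanish.\<close>
proof (cases "a = 0 \<or> b = 0")
  case False
  then have pos: "0 < a" "0 < b"
    using assms by auto
  define f :: "real \<Rightarrow> real" where "f s = - ln (1 - exp (- exp s))" for s
  have "convex_on UNIV f"
  proof (rule convex_on_realI)
    fix s :: real
    have "(f has_real_derivative - (exp s * exp (- exp s) / (1 - exp (- exp s)))) (at s)"
      unfolding f_def by (auto intro!: derivative_eq_intros)
    also have "exp s * exp (- exp s) / (1 - exp (- exp s)) = exp s / (exp (exp s) - 1)"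
      by (simp add: exp_minus field_simps)
    finally show "(f has_real_derivative - (exp s / (exp (exp s) - 1))) (at s)" .
  next
    fix s t :: real
    assume "s \<le> t"
    then show "- (exp s / (exp (exp s) - 1)) \<le> - (exp t / (exp (exp t) - 1))"
      using div_exp_minus_one_antimono[of "exp s" "exp t"] by simp
  qed simp
  from convex_onD[OF this, of "1 / 2" "ln a" "ln b"]
  have "f ((ln a + ln b) / 2) \<le> (f (ln a) + f (ln b)) / 2"
    by (simp add: field_simps)
  moreover have "exp ((ln a + ln b) / 2) = sqrt (a * b)"
  proof -
    have "(ln a + ln b) / 2 = ln (sqrt (a * b))"
      using pos by (simp add: ln_sqrt ln_mult)
    then show ?thesis
      using pos by simp
  qed
  ultimately have "ln (1 - exp (- a)) + ln (1 - exp (- b)) \<le> 2 * ln (1 - exp (- sqrt (a * b)))"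
    using pos by (simp add: f_def)
  then have "ln ((1 - exp (- a)) * (1 - exp (- b))) \<le> ln ((1 - exp (- sqrt (a * b)))\<^sup>2)"
    using pos by (simp add: ln_mult ln_realpow)
  then show ?thesis
    using pos by (simp add: zero_less_mult_iff)
qed auto

text \<open>Expanding the products cancels the constant 1 and leaves the 1 by 1 case of the trace
  inequality for g(x) = exp(-x).\<close>

lemma exp_geometric_mean:
  fixes a b :: real
  assumes "0 \<le> a" "0 \<le> b"
  shows "exp (- a) * exp (- b) - exp (- a) - exp (- b) \<le>
         exp (- (2 * sqrt (a * b))) - 2 * exp (- sqrt (a * b))"
proof -
  have "exp (- (2 * sqrt (a * b))) = (exp (- sqrt (a * b)))\<^sup>2"
    by (simp add: exp_double[symmetric])
  then show ?thesis
    using one_minus_exp_geometric_mean[OF assms] by (simp add: power2_eq_square algebra_simps)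
qed

subsection \<open>Finite combinations of point evaluations\<close>

text \<open>Captures the shape of both sides of the claim as functionals of g. Linearity, dependence
  on the values in X alone, and exchange with an integral then each follow by one induction.\<close>

inductive point_comb :: "real set \<Rightarrow> ((real \<Rightarrow> real) \<Rightarrow> real) \<Rightarrow> bool" for X where
  zero: "point_comb X (\<lambda>g. 0)"
| point: "x \<in> X \<Longrightarrow> point_comb X (\<lambda>g. w * g x)"
| add: "point_comb X F \<Longrightarrow> point_comb X G \<Longrightarrow> point_comb X (\<lambda>g. F g + G g)"

text \<open>A term of weight 0 may sit outside X; the positive definite case depends on
  this.\<close>

lemma point_comb_point: "(w \<noteq> 0 \<Longrightarrow> x \<in> X) \<Longrightarrow> point_comb X (\<lambda>g. w * g x)"
  by (cases "w = 0") (auto intro: point_comb.intros)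

lemma point_comb_cmult: "point_comb X F \<Longrightarrow> point_comb X (\<lambda>g. r * F g)"
proof (induction rule: point_comb.induct)
  case (point x w)
  then show ?case
    using point_comb.point[of x X "r * w"] by (simp add: mult.assoc)
qed (auto intro: point_comb.intros simp: distrib_left)

lemma point_comb_diff: "point_comb X F \<Longrightarrow> point_comb X G \<Longrightarrow> point_comb X (\<lambda>g. F g - G g)"
  using point_comb.add[of X F "\<lambda>g. - 1 * G g"] point_comb_cmult[of X G "- 1"] by simp

lemma point_comb_sum: "(\<And>k. k \<in> K \<Longrightarrow> point_comb X (F k)) \<Longrightarrow> point_comb X (\<lambda>g. \<Sum>k\<in>K. F k g)"
  by (induction K rule: infinite_finite_induct) (auto intro: point_comb.intros)

lemma point_comb_cong: "point_comb X F \<Longrightarrow> (\<And>x. x \<in> X \<Longrightarrow> f x = g x) \<Longrightarrow> F f = F g"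
  by (induction rule: point_comb.induct) auto

lemma point_comb_add: "point_comb X F \<Longrightarrow> F (\<lambda>x. f x + g x) = F f + F g"
  by (induction rule: point_comb.induct) (auto simp: distrib_left)

lemma point_comb_scale: "point_comb X F \<Longrightarrow> F (\<lambda>x. r * f x) = r * F f"
  by (induction rule: point_comb.induct) (auto simp: distrib_left)

lemma point_comb_integral:
  assumes "point_comb X F" "\<And>x. x \<in> X \<Longrightarrow> integrable M (h x)"
  shows "integrable M (\<lambda>t. F (\<lambda>x. h x t)) \<and> F (\<lambda>x. \<integral>t. h x t \<partial>M) = (\<integral>t. F (\<lambda>x. h x t) \<partial>M)"
  using assms by (induction rule: point_comb.induct) auto

subsection \<open>Integral representations\<close>

text \<open>By Markov's inequality the half-lines from 1/(n+1) have finite measure. Sigma-finiteness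
  is what Tonelli requires when g is integrated.\<close>

lemma sigma_finite_if_nn_integral_finite:
  fixes \<mu> :: "real measure"
  assumes "sets \<mu> = sets borel" "emeasure \<mu> {..0} = 0" "(\<integral>\<^sup>+t. ennreal (min 1 t) \<partial>\<mu>) < \<infinity>"
  shows "sigma_finite_measure \<mu>"
proof
  note [measurable_cong] = assms(1)
  let ?A = "insert {..0} (range (\<lambda>n. {1 / real (Suc n)..}))"
  show "\<exists>A. countable A \<and> A \<subseteq> sets \<mu> \<and> \<Union>A = space \<mu> \<and> (\<forall>a\<in>A. emeasure \<mu> a \<noteq> \<infinity>)"
  proof (intro exI[of _ ?A] conjI ballI)
    show "\<Union>?A = space \<mu>"
    proof -
      have "\<exists>n. 1 / real (Suc n) \<le> t" if "0 < t" for t :: real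
        using reals_Archimedean[OF that] by (metis inverse_eq_divide less_imp_le)
      then show ?thesis
        using sets_eq_imp_space_eq[OF assms(1)] by (force simp: not_le)
    qed
    have "emeasure \<mu> {1 / real (Suc n)..} \<noteq> \<infinity>" for n
    proof
      assume inf: "emeasure \<mu> {1 / real (Suc n)..} = \<infinity>"
      have "\<infinity> = ennreal (1 / real (Suc n)) * emeasure \<mu> {1 / real (Suc n)..}"
        unfolding inf by (simp add: ennreal_mult_top)
      also have "\<dots> = (\<integral>\<^sup>+t. ennreal (1 / real (Suc n)) * indicator {1 / real (Suc n)..} t \<partial>\<mu>)"
        by (subst nn_integral_cmult_indicator) (auto simp: assms(1))
      also have "\<dots> \<le> (\<integral>\<^sup>+t. ennreal (min 1 t) \<partial>\<mu>)"
        by (intro nn_integral_mono) (auto simp: indicator_def intro!: ennreal_leI)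
      finally show False
        using assms(3) by simp
    qed
    then show "emeasure \<mu> a \<noteq> \<infinity>" if "a \<in> ?A" for a
      using that assms(2) by auto
  qed (auto simp: assms(1))
qed

lemma AE_pos_if_emeasure_null:
  fixes \<mu> :: "real measure"
  assumes "sets \<mu> = sets borel" "emeasure \<mu> {..0} = 0"
  shows "AE t in \<mu>. 0 < t"
  by (rule AE_I[of _ _ "{..0}"]) (use assms in \<open>auto simp: not_less\<close>)

text \<open>Passing to an antiderivative keeps the measure and changes only the kernel
  \<open>h\<close>.\<close>

definition integral_rep :: "real measure \<Rightarrow> (real \<Rightarrow> real \<Rightarrow> real) \<Rightarrow> (real \<Rightarrow> real) \<Rightarrow> bool" where
  "integral_rep \<mu> h f \<longleftrightarrow> sets \<mu> = sets borel \<and> emeasure \<mu> {..0} = 0 \<and> sigma_finite_measure \<mu> \<and>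
     (\<forall>x\<ge>0. integrable \<mu> (h x) \<and> f x = (\<integral>t. h x t \<partial>\<mu>))"

text \<open>Tonelli, with the inner integral evaluated by the fundamental theorem of calculus.\<close>

lemma integral_rep_antiderivative:
  fixes h H :: "real \<Rightarrow> real \<Rightarrow> real"
  assumes rep: "integral_rep \<mu> h g" and g: "\<And>x. 0 \<le> x \<Longrightarrow> (g has_integral f x) {0..x}"
    and meas: "case_prod h \<in> borel_measurable (borel \<Otimes>\<^sub>M borel)" "\<And>x. H x \<in> borel_measurable borel"
    and nonneg: "\<And>s t. 0 \<le> s \<Longrightarrow> 0 < t \<Longrightarrow> 0 \<le> h s t"
    and deriv: "\<And>s t. 0 < t \<Longrightarrow> ((\<lambda>s. H s t) has_real_derivative h s t) (at s)"
    and H0: "\<And>t. H 0 t = 0"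
  shows "integral_rep \<mu> H f"
proof -
  have sets: "sets \<mu> = sets borel" and null: "emeasure \<mu> {..0} = 0" and sf: "sigma_finite_measure \<mu>"
    and int: "\<And>s. 0 \<le> s \<Longrightarrow> integrable \<mu> (h s)" and g_eq: "\<And>s. 0 \<le> s \<Longrightarrow> g s = (\<integral>t. h s t \<partial>\<mu>)"
    using rep by (simp_all add: integral_rep_def)
  note [measurable_cong] = sets
  note [measurable] = meas
  interpret \<mu>: sigma_finite_measure \<mu> by fact
  interpret pair_sigma_finite lborel \<mu> ..
  have pos: "AE t in \<mu>. 0 < t"
    using sets null by (rule AE_pos_if_emeasure_null)
  have g_nn: "ennreal (g s) = (\<integral>\<^sup>+t. ennreal (h s t) \<partial>\<mu>)" if "0 \<le> s" for s
    unfolding g_eq[OF that] using pos nonneg that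
    by (intro nn_integral_eq_integral[symmetric] int) auto
  have g_nonneg: "0 \<le> g s" if "0 \<le> s" for s
    unfolding g_eq[OF that] using pos nonneg that by (intro integral_nonneg_AE) auto
  have "integrable \<mu> (H x) \<and> f x = (\<integral>t. H x t \<partial>\<mu>)" if "0 \<le> x" for x
  proof -
    have inner: "(\<integral>\<^sup>+s. ennreal (h s t) * indicator {0..x} s \<partial>lborel) = ennreal (H x t)" if "0 < t" for t
    proof -
      have "(\<integral>\<^sup>+s. ennreal (h s t) * indicator {0..x} s \<partial>lborel) = ennreal (H x t - H 0 t)"
        using that deriv nonneg \<open>0 \<le> x\<close> by (intro nn_integral_FTC_Icc) auto
      then show ?thesis by (simp add: H0)
    qed
    have H_nonneg: "0 \<le> H x t" if "0 < t" for t
      using DERIV_nonneg_imp_nondecreasing[of 0 x "\<lambda>s. H s t"] deriv nonneg that \<open>0 \<le> x\<close> H0 by fastforce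
    have "ennreal (f x) = (\<integral>\<^sup>+s. ennreal (g s) * indicator {0..x} s \<partial>lborel)"
      using g_nonneg g[OF that] by (intro nn_integral_has_integral_lebesgue'[symmetric]) auto
    also have "\<dots> = (\<integral>\<^sup>+s. (\<integral>\<^sup>+t. ennreal (h s t) * indicator {0..x} s \<partial>\<mu>) \<partial>lborel)"
      by (intro nn_integral_cong) (auto simp: g_nn indicator_def)
    also have "\<dots> = (\<integral>\<^sup>+t. (\<integral>\<^sup>+s. ennreal (h s t) * indicator {0..x} s \<partial>lborel) \<partial>\<mu>)"
      by (intro Fubini'[symmetric]) measurable
    also have "\<dots> = (\<integral>\<^sup>+t. ennreal (H x t) \<partial>\<mu>)"
      using pos by (intro nn_integral_cong_AE) (auto simp: inner)
    \<comment> \<open>The value f x is a real number, so the integral is finite and integrability of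
      \<open>H x\<close> needs no estimate of its own.\<close>
    finally have eq: "(\<integral>\<^sup>+t. ennreal (H x t) \<partial>\<mu>) = ennreal (f x)" ..
    have "AE t in \<mu>. 0 \<le> H x t"
      using pos by eventually_elim (rule H_nonneg)
    moreover have "H x \<in> borel_measurable \<mu>"
      by measurable
    moreover have "0 \<le> f x"
      using g[OF that] by (rule has_integral_nonneg) (use g_nonneg in auto)
    ultimately show ?thesis
      using eq by (auto intro!: integrableI_nonneg integral_eq_nn_integral[THEN trans, symmetric])
  qed
  then show ?thesis
    using sets null sf by (simp add: integral_rep_def)
qed

lemma one_minus_exp_le:
  fixes x t :: real
  assumes "0 \<le> x" "0 \<le> t"
  shows "1 - exp (- x * t) \<le> (1 + x) * min 1 t"
proof -
  have "1 - exp (- x * t) \<le> x * t"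
    using exp_ge_add_one_self[of "- x * t"] by simp
  moreover have "1 - exp (- x * t) \<le> 1"
    by simp
  ultimately show ?thesis
    using assms by (auto simp: min_def algebra_simps intro: order_trans add_increasing)
qed

lemma integrable_one_minus_exp:
  fixes \<mu> :: "real measure"
  assumes "sets \<mu> = sets borel" "emeasure \<mu> {..0} = 0" "(\<integral>\<^sup>+t. ennreal (min 1 t) \<partial>\<mu>) < \<infinity>" "0 \<le> x"
  shows "integrable \<mu> (\<lambda>t. 1 - exp (- x * t))"
proof -
  note [measurable_cong] = assms(1)
  have pos: "AE t in \<mu>. 0 < t"
    using assms(1,2) by (rule AE_pos_if_emeasure_null)
  have "integrable \<mu> (\<lambda>t. min 1 t)"
    using pos assms(3) by (intro integrableI_nonneg) auto
  then have "integrable \<mu> (\<lambda>t. (1 + x) * min 1 t)"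
    by simp
  then show ?thesis
  proof (rule Bochner_Integration.integrable_bound)
    show "AE t in \<mu>. norm (1 - exp (- x * t)) \<le> norm ((1 + x) * min 1 t)"
      using pos
    proof eventually_elim
      case (elim t)
      then show ?case
        using one_minus_exp_le[of x t] assms(4) by auto
    qed
  qed simp
qed

lemma BF0_integral_rep:
  assumes "BF0 f"
  shows "\<exists>\<mu>. integral_rep \<mu> (\<lambda>x t. 1 - exp (- x * t)) f"
proof -
  obtain \<mu> :: "real measure" where \<mu>: "sets \<mu> = sets borel" "emeasure \<mu> {..0} = 0"
      "(\<integral>\<^sup>+t. ennreal (min 1 t) \<partial>\<mu>) < \<infinity>"
    and f: "\<forall>x\<ge>0. f x = (\<integral>t. (1 - exp (- x * t)) \<partial>\<mu>)"
    using assms unfolding BF0_def by (elim exE conjE)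
  have "integral_rep \<mu> (\<lambda>x t. 1 - exp (- x * t)) f"
    unfolding integral_rep_def
    using \<mu>(1,2) sigma_finite_if_nn_integral_finite[OF \<mu>] integrable_one_minus_exp[OF \<mu>] f by blast
  then show ?thesis ..
qed

lemma BF1_integral_rep:
  assumes "BF 1 f"
  shows "\<exists>\<mu>. integral_rep \<mu> (\<lambda>x t. x - (1 - exp (- x * t)) / t) f"
proof -
  obtain g where "BF0 g" and g: "\<And>x. 0 \<le> x \<Longrightarrow> (g has_integral f x) {0..x}"
    using assms by auto
  from BF0_integral_rep[OF this(1)] obtain \<mu>
    where \<mu>: "integral_rep \<mu> (\<lambda>x t. 1 - exp (- x * t)) g" ..
  have "integral_rep \<mu> (\<lambda>x t. x - (1 - exp (- x * t)) / t) f"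
  proof (rule integral_rep_antiderivative[OF \<mu> g])
    show "((\<lambda>s. s - (1 - exp (- s * t)) / t) has_real_derivative 1 - exp (- s * t)) (at s)" if "0 < t" for s t
      using that by (auto intro!: derivative_eq_intros)
  qed auto
  then show ?thesis ..
qed

lemma BF2_integral_rep:
  assumes "BF 2 f"
  shows "\<exists>\<mu>. integral_rep \<mu> (\<lambda>x t. x\<^sup>2 / 2 - x / t + (1 - exp (- x * t)) / t\<^sup>2) f"
proof -
  obtain g where "BF 1 g" and g: "\<And>x. 0 \<le> x \<Longrightarrow> (g has_integral f x) {0..x}"
    using assms by (auto simp: numeral_2_eq_2)
  from BF1_integral_rep[OF this(1)] obtain \<mu>
    where \<mu>: "integral_rep \<mu> (\<lambda>x t. x - (1 - exp (- x * t)) / t) g" ..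
  have "integral_rep \<mu> (\<lambda>x t. x\<^sup>2 / 2 - x / t + (1 - exp (- x * t)) / t\<^sup>2) f"
  proof (rule integral_rep_antiderivative[OF \<mu> g])
    show "((\<lambda>s. s\<^sup>2 / 2 - s / t + (1 - exp (- s * t)) / t\<^sup>2) has_real_derivative
        s - (1 - exp (- s * t)) / t) (at s)" if "0 < t" for s t
      using that by (auto intro!: derivative_eq_intros simp: field_simps power2_eq_square)
    show "0 \<le> s - (1 - exp (- s * t)) / t" if "0 < t" for s t :: real
      using that exp_ge_add_one_self[of "- s * t"] by (simp add: field_simps)
  qed auto
  then show ?thesis ..
qed

text \<open>F is moved under the integral while the kernel is intact, and the kernel is split only
  for fixed t, so the coefficients need be neither integrable nor measurable. The factor r selects
  the direction of the inequality.\<close>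

lemma point_comb_exp_integral_sign:
  assumes F: "point_comb {0..} F" "F (\<lambda>x. 1) = 0" "F (\<lambda>x. x) = 0" "F (\<lambda>x. x\<^sup>2) = 0"
    and F_exp: "\<And>t. 0 < t \<Longrightarrow> F (\<lambda>x. exp (- x * t)) \<le> 0"
    and rep: "integral_rep \<mu> h f"
    and h: "\<And>x t. 0 \<le> x \<Longrightarrow> 0 < t \<Longrightarrow> h x t = c0 t + c1 t * x + c2 t * x\<^sup>2 + s t * exp (- x * t)"
    and sign: "\<And>t. 0 < t \<Longrightarrow> r * s t \<le> 0"
  shows "0 \<le> r * F f"
proof -
  have \<mu>: "sets \<mu> = sets borel" "emeasure \<mu> {..0} = 0"
    and int: "\<And>x. 0 \<le> x \<Longrightarrow> integrable \<mu> (h x)"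
    and f: "\<And>x. 0 \<le> x \<Longrightarrow> f x = (\<integral>t. h x t \<partial>\<mu>)"
    using rep by (simp_all add: integral_rep_def)
  have "F f = F (\<lambda>x. \<integral>t. h x t \<partial>\<mu>)"
    using F(1) by (rule point_comb_cong) (use f in auto)
  also have "\<dots> = (\<integral>t. F (\<lambda>x. h x t) \<partial>\<mu>)"
    using point_comb_integral[OF F(1), of \<mu> h] int by auto
  finally have "r * F f = (\<integral>t. r * F (\<lambda>x. h x t) \<partial>\<mu>)"
    by simp
  also have "\<dots> \<ge> 0"
  proof (rule integral_nonneg_AE)
    show "AE t in \<mu>. 0 \<le> r * F (\<lambda>x. h x t)"
      using AE_pos_if_emeasure_null[OF \<mu>]
    proof eventually_elim
      case (elim t)
      have "F (\<lambda>x. h x t) = F (\<lambda>x. (c0 t * 1 + c1 t * x) + (c2 t * x\<^sup>2 + s t * exp (- x * t)))"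
        using F(1) by (rule point_comb_cong) (use h elim in auto)
      also have "\<dots> = s t * F (\<lambda>x. exp (- x * t))"
        by (simp only: point_comb_add[OF F(1)] point_comb_scale[OF F(1)] F(2-4) mult_zero_right add_0_left)
      finally show ?case
        using mult_nonpos_nonpos[OF sign[OF elim] F_exp[OF elim]] by (simp add: mult.assoc)
    qed
  qed
  finally show ?thesis .
qed

subsection \<open>The trace inequality\<close>

text \<open>For projectors this trace is the squared Hilbert-Schmidt norm of
  \<open>M ** N\<close>.\<close>

lemma rtr_proj_mult_nonneg:
  assumes "hermitian M" "M ** M = M" "hermitian N" "N ** N = N"
  shows "0 \<le> rtr (M ** N)"
proof -
  have "cadj (M ** N) ** (M ** N) = N ** (M ** M) ** N"
    by (simp only: cadj_mult assms(1,3)[unfolded hermitian_def] matrix_mul_assoc)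
  then have "trace (cadj (M ** N) ** (M ** N)) = trace (N ** (N ** M))"
    using assms(2) trace_mul_sym[of "N ** M" N] by simp
  then have "trace (cadj (M ** N) ** (M ** N)) = trace (M ** N)"
    using assms(4) trace_mul_sym[of N M] by (simp add: matrix_mul_assoc)
  then show ?thesis
    using rtr_cadj_mult_nonneg[of "M ** N"] by simp
qed

lemma spec_decomp_scaleR:
  assumes "spec_decomp M K a P" "0 \<le> t"
  shows "spec_decomp (t *\<^sub>R M) K (\<lambda>k. t * a k) P"
  using assms unfolding spec_decomp_def mat_of_real_mult by (auto simp: scaleR_sum_right)

locale spectral_gap =
  fixes A B :: "complex^'n^'n"
    and K :: "'k set" and a :: "'k \<Rightarrow> real" and P :: "'k \<Rightarrow> complex^'n^'n"
    and L :: "'l set" and b :: "'l \<Rightarrow> real" and Q :: "'l \<Rightarrow> complex^'n^'n"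
    and J :: "'j set" and c :: "'j \<Rightarrow> real" and R :: "'j \<Rightarrow> complex^'n^'n"
  assumes A: "spec_decomp A K a P" and B: "spec_decomp B L b Q" and AB: "spec_decomp (A + B) J c R"
begin

sublocale P: projections K P
  using A by (rule spec_decomp_projections)

sublocale Q: projections L Q
  using B by (rule spec_decomp_projections)

sublocale R: projections J R
  using AB by (rule spec_decomp_projections)

text \<open>The difference of the two sides, with A+B also resolved into eigenvalues so that g
  occurs only at explicit points.\<close>

definition gap :: "(real \<Rightarrow> real) \<Rightarrow> real" where
  "gap g = (\<Sum>j\<in>J. rtr (R j) * g (c j)) - (\<Sum>k\<in>K. rtr (P k) * g (a k)) - (\<Sum>l\<in>L. rtr (Q l) * g (b l))
     - (\<Sum>k\<in>K. \<Sum>l\<in>L. rtr (P k ** Q l) * g (2 * sqrt (a k * b l)) - 2 * rtr (P k ** Q l) * g (sqrt (a k * b l)))"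

lemma a_nonneg: "k \<in> K \<Longrightarrow> 0 \<le> a k" and b_nonneg: "l \<in> L \<Longrightarrow> 0 \<le> b l" and c_nonneg: "j \<in> J \<Longrightarrow> 0 \<le> c j"
  using A B AB by (auto simp: spec_decomp_def)

lemma sum_eq: "spec_sum J R c = spec_sum K P a + spec_sum L Q b"
  using spec_decomp_eq[OF A] spec_decomp_eq[OF B] spec_decomp_eq[OF AB] by simp

lemma trace_gap_minus_spec_bound: "trace_gap g A B - spec_bound g K a P L b Q = gap g"
  unfolding trace_gap_def spec_bound_def gap_def spec_decomp_eq[OF A] spec_decomp_eq[OF B] sum_eq[symmetric]
  by (simp add: mat_fun_spec_sum P.projections_axioms Q.projections_axioms R.projections_axioms
      trace_sub trace_add rtr_spec_sum algebra_simps)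

lemma point_comb_gap: "point_comb {0..} gap"
  unfolding gap_def using a_nonneg b_nonneg c_nonneg
  by (intro point_comb_diff point_comb_sum point_comb_point) auto

text \<open>An eigenvalue 0 can be listed only with a zero projector, hence with weight 0.\<close>

lemma point_comb_gap_pos:
  assumes "pd A" "pd B"
  shows "point_comb {0<..} gap"
proof -
  have zero: "rtr (0 :: complex^'n^'n) = 0"
    by (simp add: trace_def)
  have a: "0 < a k" if "k \<in> K" "P k \<noteq> 0" for k
    using A assms(1) that by (rule spec_decomp_pd_pos)
  have b: "0 < b l" if "l \<in> L" "Q l \<noteq> 0" for l
    using B assms(2) that by (rule spec_decomp_pd_pos)
  have "pd (A + B)"
    using assms by (auto simp: pd_iff_inner hermitian_def cadj_add matrix_vector_mult_add_rdistrib
        inner_add_right intro: add_pos_pos)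
  then have c: "0 < c j" if "j \<in> J" "R j \<noteq> 0" for j
    using spec_decomp_pd_pos[OF AB _ that] by blast
  have "0 < a k * b l" if "k \<in> K" "l \<in> L" "rtr (P k ** Q l) \<noteq> 0" for k l
    using a[OF that(1)] b[OF that(2)] that(3) zero by (cases "P k = 0"; cases "Q l = 0") auto
  then show ?thesis
    unfolding gap_def using a b c zero
    by (intro point_comb_diff point_comb_sum point_comb_point) fastforce+
qed

text \<open>With its counterpart for Q: the marginals of the weights
  \<open>rtr (P k ** Q l)\<close>, obtained by inserting a resolution of the identity.\<close>

lemma rtr_P: "rtr (P k) = (\<Sum>l\<in>L. rtr (P k ** Q l))"
proof -
  have "P k = P k ** (\<Sum>l\<in>L. Q l)"
    by (simp add: Q.complete)
  then show ?thesis
    by (metis matrix_mult_sum_right rtr_sum)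
qed

lemma rtr_Q: "rtr (Q l) = (\<Sum>k\<in>K. rtr (P k ** Q l))"
proof -
  have "Q l = (\<Sum>k\<in>K. P k) ** Q l"
    by (simp add: P.complete)
  then show ?thesis
    by (metis matrix_mult_sum_left rtr_sum)
qed

lemma gap_as_double_sum:
  "gap g = (\<Sum>j\<in>J. g (c j) * rtr (R j)) - (\<Sum>k\<in>K. \<Sum>l\<in>L.
     (g (a k) + g (b l) + g (2 * sqrt (a k * b l)) - 2 * g (sqrt (a k * b l))) * rtr (P k ** Q l))"
proof -
  have "(\<Sum>k\<in>K. rtr (P k) * g (a k)) = (\<Sum>k\<in>K. \<Sum>l\<in>L. g (a k) * rtr (P k ** Q l))"
    by (simp add: rtr_P sum_distrib_left mult.commute)
  moreover have "(\<Sum>l\<in>L. rtr (Q l) * g (b l)) = (\<Sum>k\<in>K. \<Sum>l\<in>L. g (b l) * rtr (P k ** Q l))"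
    by (subst sum.swap) (simp add: rtr_Q sum_distrib_left mult.commute)
  ultimately show ?thesis
    by (simp add: gap_def algebra_simps sum.distrib sum_subtractf)
qed

lemma gap_exp: 
  assumes "0 \<le> t"
  shows "gap (\<lambda>x. exp (- x * t)) \<le> 0"
proof -
  \<comment> \<open>Golden-Thompson was stated without a parameter, so t is absorbed into the
    matrices; the geometric mean scales by the same t.\<close>
  have "spec_decomp (t *\<^sub>R A + t *\<^sub>R B) J (\<lambda>j. t * c j) R"
    using spec_decomp_scaleR[OF AB assms] by (simp add: scaleR_add_right)
  from golden_thompson[OF spec_decomp_scaleR[OF A assms] spec_decomp_scaleR[OF B assms] this]
  have "(\<Sum>j\<in>J. exp (- c j * t) * rtr (R j)) \<le>
      (\<Sum>k\<in>K. \<Sum>l\<in>L. exp (- a k * t) * exp (- b l * t) * rtr (P k ** Q l))"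
    by (simp add: mult.commute)
  also have "\<dots> \<le> (\<Sum>k\<in>K. \<Sum>l\<in>L. (exp (- a k * t) + exp (- b l * t) +
      exp (- (2 * sqrt (a k * b l)) * t) - 2 * exp (- sqrt (a k * b l) * t)) * rtr (P k ** Q l))"
  proof (intro sum_mono mult_right_mono)
    fix k l assume kl: "k \<in> K" "l \<in> L"
    then show "0 \<le> rtr (P k ** Q l)"
      using P.herm P.idem Q.herm Q.idem by (intro rtr_proj_mult_nonneg) auto
    have "sqrt (t * a k * (t * b l)) = t * sqrt (a k * b l)"
    proof -
      have "t * a k * (t * b l) = t\<^sup>2 * (a k * b l)"
        by (simp add: power2_eq_square)
      then show ?thesis
        using assms by (simp add: real_sqrt_mult)
    qed
    then show "exp (- a k * t) * exp (- b l * t) \<le> exp (- a k * t) + exp (- b l * t) +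
        exp (- (2 * sqrt (a k * b l)) * t) - 2 * exp (- sqrt (a k * b l) * t)"
      using exp_geometric_mean[of "t * a k" "t * b l"] assms a_nonneg[OF kl(1)] b_nonneg[OF kl(2)]
      by (simp add: mult_ac)
  qed
  finally show ?thesis
    by (simp add: gap_as_double_sum)
qed

text \<open>Both sides equal minus the trace of the identity.\<close>

lemma gap_one: "gap (\<lambda>x. 1) = 0"
proof -
  have "(\<Sum>j\<in>J. rtr (R j)) = rtr (mat 1 :: complex^'n^'n)"
    using R.complete rtr_sum[of R J] by simp
  moreover have "(\<Sum>k\<in>K. rtr (P k)) = rtr (mat 1 :: complex^'n^'n)"
    using P.complete rtr_sum[of P K] by simp
  ultimately show ?thesis
    by (simp add: gap_as_double_sum rtr_P)
qed

lemma gap_id: "gap (\<lambda>x. x) = 0"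
  using arg_cong[OF sum_eq, of rtr] by (simp add: gap_def rtr_spec_sum rtr_add mult.commute)

text \<open>Both sides equal 2 tr AB: on the left it is the cross term of the square of A+B, on the
  right (2s)^2 - 2s^2 with s^2 = ab.\<close>

lemma gap_square: "gap (\<lambda>x. x\<^sup>2) = 0"
proof -
  have "spec_sum J R c ** spec_sum J R c = (spec_sum K P a + spec_sum L Q b) ** (spec_sum K P a + spec_sum L Q b)"
    by (simp add: sum_eq)
  then have "rtr (spec_sum J R c ** spec_sum J R c) =
      rtr (spec_sum K P a ** spec_sum K P a) + rtr (spec_sum L Q b ** spec_sum L Q b)
        + 2 * rtr (spec_sum K P a ** spec_sum L Q b)"
    by (simp add: matrix_add_ldistrib matrix_add_rdistrib rtr_add trace_mul_sym[of "spec_sum L Q b" "spec_sum K P a"])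
  then have "(\<Sum>j\<in>J. rtr (R j) * (c j)\<^sup>2) = (\<Sum>k\<in>K. rtr (P k) * (a k)\<^sup>2) + (\<Sum>l\<in>L. rtr (Q l) * (b l)\<^sup>2)
      + 2 * (\<Sum>k\<in>K. \<Sum>l\<in>L. a k * b l * rtr (P k ** Q l))"
    by (simp add: P.spec_sum_mult Q.spec_sum_mult R.spec_sum_mult rtr_spec_sum rtr_spec_sum_mult
        power2_eq_square mult_ac)
  moreover have "(\<Sum>k\<in>K. \<Sum>l\<in>L. rtr (P k ** Q l) * (2 * sqrt (a k * b l))\<^sup>2
        - 2 * rtr (P k ** Q l) * (sqrt (a k * b l))\<^sup>2) =
      2 * (\<Sum>k\<in>K. \<Sum>l\<in>L. a k * b l * rtr (P k ** Q l))"
    unfolding sum_distrib_left using a_nonneg b_nonneg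
    by (intro sum.cong refl) (simp add: power_mult_distrib algebra_simps)
  ultimately show ?thesis
    by (simp add: gap_def)
qed

text \<open>The coefficient of the exponential is -1 here and becomes 1/t and -1/t^2 in the next two
  classes; its sign decides the direction.\<close>

lemma gap_BF0: "BF 0 g \<Longrightarrow> 0 \<le> gap g"
proof -
  assume "BF 0 g"
  then have "BF0 g" by simp
  then obtain \<mu> where \<mu>: "integral_rep \<mu> (\<lambda>x t. 1 - exp (- x * t)) g"
    using BF0_integral_rep by blast
  have "0 \<le> 1 * gap g"
    by (rule point_comb_exp_integral_sign[OF point_comb_gap gap_one gap_id gap_square gap_exp[OF less_imp_le] \<mu>,
          where s = "\<lambda>t. - 1" and ?c0.0 = "\<lambda>t. 1" and ?c1.0 = "\<lambda>t. 0" and ?c2.0 = "\<lambda>t. 0"])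
      auto
  then show ?thesis by simp
qed

lemma gap_BF1: "BF 1 g \<Longrightarrow> gap g \<le> 0"
proof -
  assume "BF 1 g"
  then obtain \<mu> where \<mu>: "integral_rep \<mu> (\<lambda>x t. x - (1 - exp (- x * t)) / t) g"
    using BF1_integral_rep by blast
  have "0 \<le> - 1 * gap g"
    by (rule point_comb_exp_integral_sign[OF point_comb_gap gap_one gap_id gap_square gap_exp[OF less_imp_le] \<mu>,
          where s = "\<lambda>t. 1 / t" and ?c0.0 = "\<lambda>t. - 1 / t" and ?c1.0 = "\<lambda>t. 1" and ?c2.0 = "\<lambda>t. 0"])
      (auto simp: field_simps)
  then show ?thesis by simp
qed

lemma gap_BF2: "BF 2 g \<Longrightarrow> 0 \<le> gap g"
proof -
  assume "BF 2 g"
  then obtain \<mu> where \<mu>: "integral_rep \<mu> (\<lambda>x t. x\<^sup>2 / 2 - x / t + (1 - exp (- x * t)) / t\<^sup>2) g"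
    using BF2_integral_rep by blast
  have "0 \<le> 1 * gap g"
    by (rule point_comb_exp_integral_sign[OF point_comb_gap gap_one gap_id gap_square gap_exp[OF less_imp_le] \<mu>,
          where s = "\<lambda>t. - 1 / t\<^sup>2" and ?c0.0 = "\<lambda>t. 1 / t\<^sup>2" and ?c1.0 = "\<lambda>t. - 1 / t" and ?c2.0 = "\<lambda>t. 1 / 2"])
      (auto simp: field_simps)
  then show ?thesis by simp
qed

text \<open>The kernel is the exponential itself, but it is known to be integrable only for x > 0,
  so the functional must be confined to positive points.\<close>

lemma gap_CM0:
  assumes "pd A" "pd B" "CM0 g"
  shows "gap g \<le> 0"
proof -
  obtain \<mu> :: "real measure" where \<mu>: "sets \<mu> = sets borel" "emeasure \<mu> {..0} = 0"
    and g: "\<forall>x>0. integrable \<mu> (\<lambda>t. exp (- x * t)) \<and> g x = (\<integral>t. exp (- x * t) \<partial>\<mu>)"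
    using assms(3) unfolding CM0_def by blast
  note comb = point_comb_gap_pos[OF assms(1,2)]
  have "gap g = gap (\<lambda>x. \<integral>t. exp (- x * t) \<partial>\<mu>)"
    using comb by (rule point_comb_cong) (use g in auto)
  also have "\<dots> = (\<integral>t. gap (\<lambda>x. exp (- x * t)) \<partial>\<mu>)"
    using point_comb_integral[OF comb, of \<mu> "\<lambda>x t. exp (- x * t)"] g by auto
  also have "\<dots> = - (\<integral>t. - gap (\<lambda>x. exp (- x * t)) \<partial>\<mu>)"
    by simp
  also have "\<dots> \<le> 0"
    using AE_pos_if_emeasure_null[OF \<mu>] gap_exp
    by (intro iffD2[OF neg_le_0_iff_le] integral_nonneg_AE) (auto elim!: eventually_mono)
  finally show ?thesis .
qed

lemma gap_quadratic:
  assumes "quadratic_on_nonneg g"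
  shows "gap g = 0"
proof -
  obtain c0 c1 c2 where g: "\<forall>x\<ge>0. g x = c0 + c1 * x + c2 * x\<^sup>2"
    using assms unfolding quadratic_on_nonneg_def by blast
  have "gap g = gap (\<lambda>x. (c0 * 1 + c1 * x) + c2 * x\<^sup>2)"
    using point_comb_gap by (rule point_comb_cong) (use g in auto)
  also have "\<dots> = 0"
    by (simp only: point_comb_add[OF point_comb_gap] point_comb_scale[OF point_comb_gap]
        gap_one gap_id gap_square mult_zero_right add_0_left)
  finally show ?thesis .
qed

end

theorem mainTheorem8:
  fixes A B :: "complex^'n^'n"
    and K :: "'k set" and a :: "'k \<Rightarrow> real" and P :: "'k \<Rightarrow> complex^'n^'n"
    and L :: "'l set" and b :: "'l \<Rightarrow> real" and Q :: "'l \<Rightarrow> complex^'n^'n"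
  assumes "spec_decomp A K a P" and "spec_decomp B L b Q"
  shows "(\<forall>g. BF 1 g \<longrightarrow> trace_gap g A B \<le> spec_bound g K a P L b Q)
       \<and> (pd A \<and> pd B \<longrightarrow> (\<forall>g. CM0 g \<longrightarrow> trace_gap g A B \<le> spec_bound g K a P L b Q))
       \<and> (\<forall>g. BF 0 g \<or> BF 2 g \<longrightarrow> trace_gap g A B \<ge> spec_bound g K a P L b Q)
       \<and> (\<forall>g. quadratic_on_nonneg g \<longrightarrow> trace_gap g A B = spec_bound g K a P L b Q)"
proof -
  have "hermitian (A + B)"
    using projections.hermitian_spec_sum[OF spec_decomp_projections] assms spec_decomp_eq
    by (metis cadj_add hermitian_def)
  moreover have "0 \<le> x \<bullet> ((A + B) *v x)" for x
    using assms by (simp add: matrix_vector_mult_add_rdistrib inner_add_right spec_decomp_inner_nonneg)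
  \<comment> \<open>Only A and B come with decompositions; the spectral theorem supplies one for
    A+B, with nonnegative eigenvalues since the sum is positive semidefinite.\<close>
  ultimately obtain c and R :: "'n \<Rightarrow> complex^'n^'n" where "spec_decomp (A + B) UNIV c R"
    using spec_decomp_exists by metis
  then interpret spectral_gap A B K a P L b Q UNIV c R
    using assms by unfold_locales
  show ?thesis
  proof (intro conjI allI impI)
    fix g
    show "trace_gap g A B \<le> spec_bound g K a P L b Q" if "BF 1 g"
      using gap_BF1[OF that] trace_gap_minus_spec_bound[of g] by simp
    show "trace_gap g A B \<le> spec_bound g K a P L b Q" if "pd A \<and> pd B" "CM0 g"
      using gap_CM0[of g] that trace_gap_minus_spec_bound[of g] by simp
    show "trace_gap g A B \<ge> spec_bound g K a P L b Q" if "BF 0 g \<or> BF 2 g"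
      using gap_BF0 gap_BF2 that trace_gap_minus_spec_bound[of g] by fastforce
    show "trace_gap g A B = spec_bound g K a P L b Q" if "quadratic_on_nonneg g"
      using gap_quadratic[OF that] trace_gap_minus_spec_bound[of g] by simp
  qed
qed

end
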